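(* Let $C>0$. For each $n\ge1$ let $\{A_j\}$ be a partition of the sphere $\{\mathbf x\in\mathbb R^3:|\mathbf x|=\sqrt n\}$ into sets each of diameter at most $C n^{1/4}$. Then for every $\epsilon>0$, $$\sum_j\big(\#(A_j\cap\mathcal E(n))\big)^2\ll_{C,\epsilon} n^{1/2+\epsilon}.$$
   Context: $\mathcal E(n)=\{\mathbf x\in\mathbb Z^3:|\mathbf x|^2=n\}$. *)

theory Defs
  imports "HOL-Analysis.Analysis"
begin

definition latticeSphere :: "nat \<Rightarrow> (real^3) set" where
  "latticeSphere n = {x. (\<forall>i. x $ i \<in> \<int>) \<and> norm x ^ 2 = real n}"

end

theory Submission
  imports Defs "HOL-Computational_Algebra.Primes"
begin

text \<open>
  The sum is at most the number of pairs \<open>x, y\<close> of lattice points on the sphere at distance at most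
  \<open>C n^(1/4)\<close>. The vectors \<open>z = x + y\<close> and \<open>d = x - y\<close> are orthogonal, and their square norms \<open>m\<close> and
  \<open>h\<close> satisfy \<open>m + h = 4 n\<close> and \<open>h \<le> C^2 n^(1/2)\<close>. The key estimate is that at most
  \<open>gcd (m, h) n^\<epsilon>\<close> orthogonal integral pairs have square norms \<open>m\<close> and \<open>h\<close>, up to a constant;
  since \<open>gcd (m, h) = gcd (4 n, h)\<close>, summing over \<open>h\<close> costs only a further divisor function.

  For the key estimate let \<open>w = z \<times> d\<close>, let \<open>e\<close> be the content of \<open>w\<close>, and describe an integer
  vector \<open>v\<close> by its coordinates \<open>(v \<bullet> z, v \<bullet> d, v \<bullet> w)\<close>. The lattice of all such coordinates
  determines the pair up to signed permutations of the axes, because integer vectors of length one are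
  signed basis vectors. This lattice is generated by its part with \<open>v \<bullet> w = 0\<close>, a subgroup \<open>K\<close> of
  the integral plane containing \<open>(m, 0)\<close> and \<open>(0, h)\<close>, and one vector with \<open>v \<bullet> w = e\<close>. There are
  at most \<open>gcd (m, h) \<tau>(m) \<tau>(h)\<close> subgroups \<open>K\<close>. For fixed \<open>K\<close> and \<open>e\<close> the extra generators
  differ modulo \<open>K\<close> by factors \<open>k\<close> with \<open>k^2 \<equiv> 1\<close> modulo \<open>m h / e^2\<close>, by integrality of the norm,
  and the number of such \<open>k\<close> is bounded by the divisor function.
\<close>

subsection \<open>Divisors and square roots of one\<close>

text \<open>The divisor function on positive integers. At 0 the set is infinite, so the value there
  is the default 0; hence the positivity assumptions below.\<close>

definition tau :: "int \<Rightarrow> nat" where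
  "tau n = card {d. 0 < d \<and> d dvd n}"

lemma finite_pos_divisors: "finite {d::int. 0 < d \<and> d dvd n}" if "n > 0"
  by (rule finite_subset[of _ "{0..n}"]) (auto dest: zdvd_imp_le simp: that)

lemma tau_mono: "tau a \<le> tau b" if "a dvd b" "b > 0"
  unfolding tau_def
  by (rule card_mono) (use that finite_pos_divisors in \<open>auto intro: dvd_trans\<close>)

lemma card_divisors_prime_power_mult_le:
  fixes p n a :: nat
  assumes "prime p" "n > 0"
  shows "card {d. d dvd p ^ a * n} \<le> (a + 1) * card {d. d dvd n}"
proof -
  have fin: "finite ({..a} \<times> {d. d dvd n})" using assms(2) by simp
  have "{d. d dvd p ^ a * n} \<subseteq> (\<lambda>(i, d). p ^ i * d) ` ({..a} \<times> {d. d dvd n})"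
  proof
    fix d assume "d \<in> {d. d dvd p ^ a * n}"
    then obtain b c where "d = b * c" "b dvd p ^ a" "c dvd n"
      using division_decomp by blast
    then show "d \<in> (\<lambda>(i, d). p ^ i * d) ` ({..a} \<times> {d. d dvd n})"
      using divides_primepow_nat[OF assms(1)] by auto
  qed
  then have "card {d. d dvd p ^ a * n} \<le> card ({..a} \<times> {d. d dvd n})"
    using surj_card_le[OF fin] by blast
  then show ?thesis by (simp add: card_cartesian_product)
qed

text \<open>Induction on \<open>n\<close>, splitting off the full power \<open>p ^ a\<close> of a
  prime divisor, which costs a factor \<open>a + 1\<close>. For \<open>p \<ge> X\<close> this is at
  most \<open>2 ^ a\<close>, hence at most \<open>(p powr \<epsilon>) ^ a\<close>; each prime below
  \<open>X\<close> costs one extra factor \<open>A\<close>.\<close>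

lemma card_divisors_le_small_primes:
  fixes \<epsilon> A :: real and n X :: nat
  assumes "A \<ge> 1" "\<epsilon> > 0"
    and large: "\<And>p. p \<ge> X \<Longrightarrow> 2 \<le> real p powr \<epsilon>"
    and small: "\<And>a::nat. real a + 1 \<le> A * (2 powr \<epsilon>) ^ a"
    and "n > 0"
  shows "real (card {d. d dvd n}) \<le> A ^ card {p. prime p \<and> p dvd n \<and> p < X} * real n powr \<epsilon>"
  using \<open>n > 0\<close>
proof (induction n rule: less_induct)
  case (less n)
  show ?case
  proof (cases "n = 1")
    case True
    then show ?thesis using assms(1) by (simp add: one_le_power)
  next
    case False
    then obtain p where p: "prime p" "p dvd n" using prime_factor_nat by blast
    define a where "a = multiplicity p n"
    obtain n' where n': "n = p ^ a * n'" "\<not> p dvd n'"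
      using multiplicity_decompose'[of n p] less.prems p(1) not_prime_unit[of p] unfolding a_def
      by blast
    have "a > 0" using n' p by (cases a) auto
    have "n' > 0" using less.prems n' by (cases n') auto
    have "p > 1" using p(1) prime_gt_1_nat by blast
    have "p ^ a > 1" using \<open>p > 1\<close> \<open>a > 0\<close> by (rule one_less_power)
    then have "n' < n" using n'(1) \<open>n' > 0\<close> by simp
    let ?S = "\<lambda>n. {q. prime q \<and> q dvd n \<and> q < X}"
    have IH: "real (card {d. d dvd n'}) \<le> A ^ card (?S n') * real n' powr \<epsilon>"
      using less.IH[OF \<open>n' < n\<close> \<open>n' > 0\<close>] .
    have fin: "finite (?S n')" by (rule finite_subset[of _ "{..<X}"]) auto
    have pdvd: "q dvd n \<longleftrightarrow> q = p \<or> q dvd n'" if "prime q" for q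
      using that p(1) n'(1) \<open>a > 0\<close>
      by (auto simp: prime_dvd_mult_iff prime_dvd_power_iff primes_dvd_imp_eq)
    have npow: "real n powr \<epsilon> = (real p powr \<epsilon>) ^ a * real n' powr \<epsilon>"
    proof -
      have "(real p ^ a) powr \<epsilon> = (real p powr \<epsilon>) ^ a"
        using \<open>p > 1\<close> by (induction a) (auto simp: powr_mult)
      then show ?thesis using n'(1) by (simp add: powr_mult)
    qed
    have key: "(real a + 1) * A ^ card (?S n') \<le> A ^ card (?S n) * (real p powr \<epsilon>) ^ a"
    proof (cases "p < X")
      case True
      have "?S n = insert p (?S n')" using pdvd p True by auto
      then have c: "card (?S n) = Suc (card (?S n'))"
        using fin n'(2) by simp
      have "real a + 1 \<le> A * (2 powr \<epsilon>) ^ a" by (rule small)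
      also have "\<dots> \<le> A * (real p powr \<epsilon>) ^ a"
        using assms(1,2) \<open>p > 1\<close> by (intro mult_left_mono power_mono powr_mono2) auto
      finally have "A ^ card (?S n') * (real a + 1) \<le> A ^ card (?S n') * (A * (real p powr \<epsilon>) ^ a)"
        using assms(1) by (intro mult_left_mono) auto
      then show ?thesis by (simp add: c mult_ac)
    next
      case False
      then have c: "?S n = ?S n'" using pdvd by auto
      have "real a + 1 \<le> 2 ^ a"
      proof -
        have "Suc a \<le> 2 ^ a" by (rule Suc_leI) (rule less_exp)
        then have "real (Suc a) \<le> real (2 ^ a)" by (simp only: of_nat_le_iff)
        then show ?thesis by simp
      qed
      also have "\<dots> \<le> (real p powr \<epsilon>) ^ a"
        using large False by (intro power_mono) auto
      finally have "A ^ card (?S n') * (real a + 1) \<le> A ^ card (?S n') * (real p powr \<epsilon>) ^ a"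
        using assms(1) by (intro mult_left_mono) auto
      then show ?thesis by (simp add: c mult_ac)
    qed
    have "real (card {d. d dvd n}) \<le> (real a + 1) * real (card {d. d dvd n'})"
    proof -
      have "card {d. d dvd n} \<le> (a + 1) * card {d. d dvd n'}"
        using card_divisors_prime_power_mult_le[OF p(1) \<open>n' > 0\<close>, of a] n'(1) by simp
      then have "real (card {d. d dvd n}) \<le> real ((a + 1) * card {d. d dvd n'})"
        by (simp only: of_nat_le_iff)
      then show ?thesis by (simp add: algebra_simps)
    qed
    also have "\<dots> \<le> (real a + 1) * (A ^ card (?S n') * real n' powr \<epsilon>)"
      using IH by (intro mult_left_mono) auto
    also have "\<dots> = ((real a + 1) * A ^ card (?S n')) * real n' powr \<epsilon>" by simp
    also have "\<dots> \<le> (A ^ card (?S n) * (real p powr \<epsilon>) ^ a) * real n' powr \<epsilon>"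
      by (intro mult_right_mono key) auto
    finally show ?thesis by (simp add: npow mult_ac)
  qed
qed

lemma divisor_bound:
  fixes \<epsilon> :: real
  assumes "\<epsilon> > 0"
  shows "\<exists>B\<ge>1. \<forall>n>0. real (tau n) \<le> B * of_int n powr \<epsilon>"
proof -
  \<comment> \<open>This \<open>A\<close> gives
    \<open>a + 1 \<le> A * (1 + a * \<epsilon> * ln 2)\<close>, and the bracket is at most
    \<open>(2 powr \<epsilon>) ^ a\<close> by \<open>1 + x \<le> exp x\<close>. From
    \<open>X\<close> on, \<open>p powr \<epsilon>\<close> is at least 2.\<close>
  define A where "A = 1 + 1 / (\<epsilon> * ln 2)"
  define X where "X = nat \<lceil>2 powr (1 / \<epsilon>)\<rceil>"
  have A1: "A \<ge> 1" using assms by (simp add: A_def)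
  have large: "2 \<le> real p powr \<epsilon>" if "p \<ge> X" for p
  proof -
    have "2 powr (1 / \<epsilon>) \<le> real p"
      using that unfolding X_def by linarith
    then have "(2 powr (1 / \<epsilon>)) powr \<epsilon> \<le> real p powr \<epsilon>"
      using assms by (intro powr_mono2) auto
    then show ?thesis using assms by (simp add: powr_powr)
  qed
  have small: "real a + 1 \<le> A * (2 powr \<epsilon>) ^ a" for a :: nat
  proof -
    have "(2 powr \<epsilon>) ^ a = exp (real a * (\<epsilon> * ln 2))"
      by (simp add: powr_def exp_of_nat_mult)
    also have "\<dots> \<ge> 1 + real a * (\<epsilon> * ln 2)" by (rule exp_ge_add_one_self)
    finally have "A * (1 + real a * (\<epsilon> * ln 2)) \<le> A * (2 powr \<epsilon>) ^ a"
      using A1 by (intro mult_left_mono) auto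
    moreover have "real a + 1 \<le> A * (1 + real a * (\<epsilon> * ln 2))"
      using assms by (simp add: A_def field_simps)
    ultimately show ?thesis by linarith
  qed
  have "real (tau n) \<le> A ^ X * of_int n powr \<epsilon>" if "n > 0" for n
  proof -
    let ?N = "nat n"
    have "{d. 0 < d \<and> d dvd n} = int ` {d. d dvd ?N}"
    proof (intro equalityI subsetI)
      fix d assume "d \<in> {d. 0 < d \<and> d dvd n}"
      then show "d \<in> int ` {d. d dvd ?N}"
        using that by (intro image_eqI[of _ _ "nat d"]) (auto simp: nat_dvd_iff)
    next
      fix d assume "d \<in> int ` {d. d dvd ?N}"
      then obtain k where k: "d = int k" "k dvd ?N" by blast
      then have "k > 0" using that by (auto intro: Nat.gr0I)
      moreover have "int k dvd int ?N" using k by (simp only: int_dvd_int_iff)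
      ultimately show "d \<in> {d. 0 < d \<and> d dvd n}" using k that by simp
    qed
    then have "tau n = card {d. d dvd ?N}"
      by (simp add: tau_def card_image)
    then have "real (tau n) \<le> A ^ card {p. prime p \<and> p dvd ?N \<and> p < X} * real ?N powr \<epsilon>"
      using card_divisors_le_small_primes[of A \<epsilon> X ?N] A1 assms large small that by simp
    \<comment> \<open>There are at most \<open>X\<close> primes below \<open>X\<close>, so the
      constant becomes independent of \<open>n\<close>.\<close>
    also have "\<dots> \<le> A ^ X * real ?N powr \<epsilon>"
    proof (intro mult_right_mono power_increasing A1)
      show "card {p. prime p \<and> p dvd ?N \<and> p < X} \<le> X"
        using card_mono[of "{..<X}" "{p. prime p \<and> p dvd ?N \<and> p < X}"] by auto
    qed auto
    finally show ?thesis using that by simp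
  qed
  then show ?thesis using A1 by (intro exI[of _ "A ^ X"]) auto
qed

text \<open>If \<open>u = gcd (k - 1, N)\<close>, then \<open>k \<equiv> 1 (mod u)\<close> and \<open>k \<equiv> -1 (mod N / u)\<close>, and the greatest
  common divisor of these two moduli divides 2; so each \<open>u\<close> belongs to at most two values of \<open>k\<close>.\<close>

lemma card_square_roots_of_one_le:
  fixes N :: int
  assumes "N > 0"
  shows "card {k\<in>{0..<N}. N dvd k\<^sup>2 - 1} \<le> 2 * tau N"
proof -
  let ?R = "{k\<in>{0..<N}. N dvd k\<^sup>2 - 1}"
  let ?g = "\<lambda>k. gcd (k - 1) N"
  have finR: "finite ?R" by (rule finite_subset[of _ "{0..<N}"]) auto
  have fibre: "card {k\<in>?R. ?g k = u} \<le> 2" for u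
  proof (cases "{k\<in>?R. ?g k = u} = {}")
    case True
    then show ?thesis by (metis card.empty zero_le)
  next
    case False
    then obtain k0 where k0: "k0 \<in> ?R" "?g k0 = u" by auto
    have u: "u > 0" "u dvd N" using k0 assms by auto
    obtain v where v: "N = u * v" using u by auto
    have "v > 0" using v u assms by (simp add: zero_less_mult_iff)
    have cong: "u dvd k - 1 \<and> v dvd k + 1" if k: "k \<in> ?R" "?g k = u" for k
    proof
      show "u dvd k - 1" using k by auto
      then obtain t where t: "k - 1 = u * t" by auto
      have "gcd (u * t) (u * v) = u" using k t v by auto
      then have "u * gcd t v = u" using u by (simp add: gcd_mult_left)
      then have "coprime v t" using u by (simp add: coprime_iff_gcd_eq_1 gcd.commute)
      have "N dvd (k - 1) * (k + 1)" using k by (simp add: power2_eq_square algebra_simps)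
      then have "u * v dvd u * (t * (k + 1))" using t v by (simp add: mult_ac)
      then have "v dvd t * (k + 1)" using u by simp
      then show "v dvd k + 1" using \<open>coprime v t\<close> by (simp add: coprime_dvd_mult_right_iff)
    qed
    have gd: "gcd u v dvd 2"
    proof -
      have "gcd u v dvd (k0 + 1) - (k0 - 1)"
        using cong[OF k0] by (meson dvd_diff dvd_trans gcd_dvd1 gcd_dvd2)
      then show ?thesis by simp
    qed
    \<comment> \<open>Both moduli divide \<open>k - k'\<close>, hence so does their lcm; since their
      gcd divides 2 and gcd times lcm is \<open>N\<close>, the factor 2 makes up for the lack of
      coprimality.\<close>
    have diff: "N dvd 2 * (k - k')" if "k \<in> ?R" "?g k = u" "k' \<in> ?R" "?g k' = u" for k k'
    proof -
      have "u dvd (k - 1) - (k' - 1)" "v dvd (k + 1) - (k' + 1)"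
        using cong[OF that(1,2)] cong[OF that(3,4)] dvd_diff by blast+
      then have "lcm u v dvd k - k'" by simp
      then have "gcd u v * lcm u v dvd 2 * (k - k')" using gd by (rule mult_dvd_mono[rotated])
      moreover have "gcd u v * lcm u v = N" using u \<open>v > 0\<close> v by (simp add: abs_mult)
      ultimately show ?thesis by simp
    qed
    \<comment> \<open>For even \<open>N\<close> the value \<open>k\<close> is fixed modulo
      \<open>N div 2\<close>, which leaves two representatives in \<open>{0..<N}\<close>; for odd
      \<open>N\<close> the 2 cancels and only \<open>k0\<close> remains.\<close>
    have "{k\<in>?R. ?g k = u} \<subseteq> (if even N then {k0 mod (N div 2), k0 mod (N div 2) + N div 2} else {k0})"
    proof
      fix k assume "k \<in> {k\<in>?R. ?g k = u}"
      then have k: "k \<in> ?R" "?g k = u" by auto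
      have d: "N dvd 2 * (k - k0)" using diff k k0 by blast
      show "k \<in> (if even N then {k0 mod (N div 2), k0 mod (N div 2) + N div 2} else {k0})"
      proof (cases "even N")
        case True
        then obtain H where H: "N = 2 * H" by auto
        have "H > 0" using H assms by simp
        have "2 * H dvd 2 * (k - k0)" using d H by simp
        then have "H dvd k - k0" by (subst (asm) dvd_mult_cancel_left) simp
        then have "k mod H = k0 mod H" by (simp add: mod_eq_dvd_iff)
        moreover have "k = k mod H \<or> k = k mod H + H"
        proof (cases "k < H")
          case True then show ?thesis using k by auto
        next
          case False
          then have "k - H \<ge> 0" "k - H < H" using k H by auto
          then have "(k - H) mod H = k - H" by (rule mod_pos_pos_trivial)
          then have "k mod H = k - H" by (metis minus_mod_self2)
          then show ?thesis by simp
        qed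
        ultimately show ?thesis using True H by auto
      next
        case False
        then have "coprime N 2" by simp
        then have "N dvd k - k0" using d coprime_dvd_mult_right_iff by blast
        then have "k mod N = k0 mod N" by (simp add: mod_eq_dvd_iff)
        then show ?thesis using k k0 False by auto
      qed
    qed
    then have "card {k\<in>?R. ?g k = u} \<le> card (if even N then {k0 mod (N div 2), k0 mod (N div 2) + N div 2} else {k0})"
      by (intro card_mono) auto
    also have "\<dots> \<le> 2" by (simp add: card_insert_if)
    finally show ?thesis .
  qed
  have "card ?R = (\<Sum>u\<in>?g ` ?R. card {k\<in>?R. ?g k = u})"
    using sum.image_gen[OF finR, of "\<lambda>_. 1::nat" ?g] by simp
  also have "\<dots> \<le> (\<Sum>u\<in>?g ` ?R. 2)" by (intro sum_mono fibre)
  also have "\<dots> = 2 * card (?g ` ?R)" by simp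
  also have "\<dots> \<le> 2 * tau N"
    unfolding tau_def
    by (intro mult_le_mono2 card_mono finite_pos_divisors[OF assms]) (use assms in auto)
  finally show ?thesis .
qed

subsection \<open>Subgroups of the integral plane\<close>

text \<open>Division with remainder by the least positive element, which exists because of
  \<open>m\<close>.\<close>

lemma int_subgroup_principal:
  fixes H :: "int set"
  assumes "\<And>x y. x \<in> H \<Longrightarrow> y \<in> H \<Longrightarrow> x - y \<in> H" "m \<in> H" "m > 0"
  shows "\<exists>a>0. \<forall>x. x \<in> H \<longleftrightarrow> a dvd x"
proof -
  have zero: "0 \<in> H" using assms(1)[OF assms(2,2)] by simp
  have neg: "- x \<in> H" if "x \<in> H" for x using assms(1)[OF zero that] by simp
  have add: "x + y \<in> H" if "x \<in> H" "y \<in> H" for x y using assms(1)[OF that(1) neg[OF that(2)]] by simp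
  define a where "a = (LEAST n::nat. n > 0 \<and> int n \<in> H)"
  have ex: "nat m > 0 \<and> int (nat m) \<in> H" using assms by simp
  have a: "a > 0" "int a \<in> H" using LeastI[of "\<lambda>n. n > 0 \<and> int n \<in> H", OF ex] by (auto simp: a_def)
  have least: "a \<le> n" if "n > 0" "int n \<in> H" for n unfolding a_def using that by (intro Least_le) simp
  have multn: "int n * int a \<in> H" for n
  proof (induction n)
    case 0 then show ?case using zero by simp
  next
    case (Suc n)
    have "int (Suc n) * int a = int n * int a + int a" by (simp add: algebra_simps)
    then show ?case using add[OF Suc a(2)] by (simp only:)
  qed
  have mult: "k * int a \<in> H" for k
  proof (cases "k \<ge> 0")
    case True then show ?thesis using multn[of "nat k"] by simp
  next
    case False then show ?thesis using neg[OF multn[of "nat (-k)"]] by simp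
  qed
  have "int a dvd x" if "x \<in> H" for x
  proof (rule ccontr)
    assume "\<not> int a dvd x"
    then have "x mod int a \<noteq> 0" by (simp add: dvd_eq_mod_eq_0)
    then have r: "0 < x mod int a" "x mod int a < int a" 
      using a(1) pos_mod_sign[of "int a" x] pos_mod_bound[of "int a" x] by linarith+
    have "x - (x div int a) * int a \<in> H" using assms(1) that mult by blast
    then have "x mod int a \<in> H" by (simp add: minus_div_mult_eq_mod)
    then have "a \<le> nat (x mod int a)" using least[of "nat (x mod int a)"] r by simp
    then show False using r by simp
  qed
  then show ?thesis using a mult by (intro exI[of _ "int a"]) (auto simp: dvd_def mult.commute)
qed

definition pair_subgroup :: "(int \<times> int) set \<Rightarrow> bool" where
  "pair_subgroup K \<longleftrightarrow> (0, 0) \<in> K \<and> (\<forall>x\<in>K. \<forall>y\<in>K. x - y \<in> K)"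

lemma pair_subgroup_minus: "pair_subgroup K \<Longrightarrow> x \<in> K \<Longrightarrow> y \<in> K \<Longrightarrow> x - y \<in> K"
  by (simp add: pair_subgroup_def)

lemma pair_subgroup_add:
  assumes "pair_subgroup K" "x \<in> K" "y \<in> K"
  shows "x + y \<in> K"
proof -
  have "(0, 0) - y \<in> K" using assms by (simp add: pair_subgroup_def)
  then have "x - ((0, 0) - y) \<in> K" using assms by (simp add: pair_subgroup_def)
  then show ?thesis by (cases x; cases y) simp
qed

lemma pair_subgroup_scale:
  assumes "pair_subgroup K" "(a, b) \<in> K"
  shows "(k * a, k * b) \<in> K"
proof -
  have n: "(int n * a, int n * b) \<in> K" for n
  proof (induction n)
    case 0 then show ?case using assms by (simp add: pair_subgroup_def)
  next
    case (Suc n)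
    from pair_subgroup_add[OF assms(1) this assms(2)] show ?case by (simp add: algebra_simps)
  qed
  show ?thesis
  proof (cases "k \<ge> 0")
    case True then show ?thesis using n[of "nat k"] by simp
  next
    case False
    have "(0, 0) \<in> K" using assms(1) by (simp add: pair_subgroup_def)
    then have "(0, 0) - (int (nat (-k)) * a, int (nat (-k)) * b) \<in> K"
      using pair_subgroup_minus[OF assms(1)] n by blast
    moreover have "int (nat (-k)) = - k" using False by simp
    ultimately show ?thesis by (simp only: diff_Pair mult_minus_left) simp
  qed
qed

text \<open>After division by \<open>g = gcd a t\<close> the cofactors are coprime, so
  \<open>s\<close> must be a multiple of \<open>a / g\<close>, and exactly \<open>g\<close> of these
  lie in \<open>{0..<a}\<close>.\<close>

lemma card_dvd_mult_le:
  fixes a t :: int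
  assumes "a > 0"
  shows "int (card {s\<in>{0..<a}. a dvd t * s}) \<le> gcd a t"
proof -
  define g where "g = gcd a t"
  have g: "g > 0" using assms by (simp add: g_def)
  obtain a' t' where at: "a = g * a'" "t = g * t'" unfolding g_def by (meson gcd_dvd1 gcd_dvd2 dvdE)
  have "gcd (g * a') (g * t') = g" using g_def at by simp
  then have cop: "coprime a' t'" using g by (simp add: gcd_mult_left coprime_iff_gcd_eq_1)
  have a': "a' > 0" using at g assms by (simp add: zero_less_mult_iff)
  have "{s\<in>{0..<a}. a dvd t * s} \<subseteq> (\<lambda>j. a' * j) ` {0..<g}"
  proof
    fix s assume s: "s \<in> {s\<in>{0..<a}. a dvd t * s}"
    then have "g * a' dvd g * (t' * s)" by (simp add: at mult_ac)
    then have "a' dvd s" using g cop by (simp add: coprime_dvd_mult_right_iff)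
    then obtain j where j: "s = a' * j" by auto
    then have "0 \<le> j" using s a' by (simp add: zero_le_mult_iff)
    moreover have "j < g" using s j at a' by (simp add: mult.commute)
    ultimately show "s \<in> (\<lambda>j. a' * j) ` {0..<g}" using j by auto
  qed
  then have "card {s\<in>{0..<a}. a dvd t * s} \<le> card {0..<g}"
    by (rule surj_card_le[rotated]) simp
  then have "int (card {s\<in>{0..<a}. a dvd t * s}) \<le> g" using g by (simp add: le_nat_iff)
  then show ?thesis by (simp only: g_def)
qed

text \<open>Hermite normal form: \<open>K\<close> is generated by \<open>(a, 0)\<close> and
  \<open>(s, b)\<close> with \<open>0 \<le> s < a\<close>. Membership of \<open>(m, 0)\<close>
  forces \<open>a dvd m\<close>; membership of \<open>(0, h)\<close> forces \<open>b dvd h\<close>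
  and \<open>a dvd (h div b) * s\<close>, which leaves at most \<open>gcd a (h div b)\<close> values
  of \<open>s\<close>.\<close>

lemma card_subgroups_le:
  fixes m h :: int
  assumes "m > 0" "h > 0"
  defines "\<K> \<equiv> {K. pair_subgroup K \<and> (m, 0) \<in> K \<and> (0, h) \<in> K}"
  shows "finite \<K>" "card \<K> \<le> nat (gcd m h) * tau m * tau h"
proof -
  let ?A = "{a. 0 < a \<and> a dvd m}" and ?B = "{b. 0 < b \<and> b dvd h}"
  let ?S = "\<lambda>(a, b). {s\<in>{0..<a}. a dvd (h div b) * s}"
  let ?I = "Sigma (?A \<times> ?B) ?S"
  let ?f = "\<lambda>((a, b), s). {(x, y). b dvd y \<and> a dvd x - (y div b) * s}"
  have finAB: "finite (?A \<times> ?B)" using finite_pos_divisors assms by simp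
  have finS: "finite (?S ab)" for ab
    by (rule finite_subset[of _ "{0..<fst ab}"]) (auto simp: case_prod_beta)
  have finI: "finite ?I" by (rule finite_SigmaI[OF finAB finS])
  have sub: "\<K> \<subseteq> ?f ` ?I"
  proof
    fix K assume "K \<in> \<K>"
    then have K: "pair_subgroup K" "(m, 0) \<in> K" "(0, h) \<in> K" by (auto simp: \<K>_def)
    note dK = pair_subgroup_minus[OF K(1)]
    have "\<exists>a>0. \<forall>x. x \<in> {x. (x, 0) \<in> K} \<longleftrightarrow> a dvd x"
      by (rule int_subgroup_principal[of _ m]) (use dK K assms in force)+
    then obtain a where a: "a > 0" "\<And>x. (x, 0) \<in> K \<longleftrightarrow> a dvd x" by auto
    have "\<exists>b>0. \<forall>y. y \<in> {y. \<exists>x. (x, y) \<in> K} \<longleftrightarrow> b dvd y"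
    proof (rule int_subgroup_principal[of _ h])
      fix y y' assume "y \<in> {y. \<exists>x. (x, y) \<in> K}" "y' \<in> {y. \<exists>x. (x, y) \<in> K}"
      then obtain x x' where "(x, y) \<in> K" "(x', y') \<in> K" by auto
      from dK[OF this] show "y - y' \<in> {y. \<exists>x. (x, y) \<in> K}" by auto
    qed (use K assms in auto)
    then obtain b where b: "b > 0" "\<And>y. (\<exists>x. (x, y) \<in> K) \<longleftrightarrow> b dvd y" by auto
    obtain s0 where s0: "(s0, b) \<in> K" using b(2)[of b] by auto
    define s where "s = s0 mod a"
    \<comment> \<open>The shift matters only modulo \<open>a\<close>, since multiples of
      \<open>(a, 0)\<close> lie in \<open>K\<close>; the reduced one ranges over a finite
      set.\<close>
    have "(s0 - s, 0) \<in> K" unfolding a(2) s_def by (simp add: minus_mod_eq_mult_div)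
    from dK[OF s0 this] have s: "(s, b) \<in> K" by simp
    have mem: "(x, y) \<in> K \<longleftrightarrow> b dvd y \<and> a dvd x - (y div b) * s" for x y
    proof (cases "b dvd y")
      case True
      then have ys: "((y div b) * s, y) \<in> K"
        using pair_subgroup_scale[OF K(1) s, of "y div b"] by simp
      have "(x, y) \<in> K \<longleftrightarrow> (x - (y div b) * s, 0) \<in> K"
        using dK[OF _ ys, of "(x, y)"] pair_subgroup_add[OF K(1) _ ys, of "(x - (y div b) * s, 0)"]
        by auto
      then show ?thesis using True a by simp
    next
      case False
      then show ?thesis using b(2) by auto
    qed
    have "a dvd m" using a K by blast
    moreover have bh: "b dvd h" using b K by blast
    moreover have "a dvd (h div b) * s"
      using mem[of 0 h] K by simp
    moreover have "s \<in> {0..<a}" using a by (simp add: s_def)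
    ultimately have "((a, b), s) \<in> ?I" using a b by simp
    moreover have "K = ?f ((a, b), s)" using mem by auto
    ultimately show "K \<in> ?f ` ?I" by blast
  qed
  show "finite \<K>" using finite_surj[OF finI sub] .
  have "card \<K> \<le> card ?I" by (rule surj_card_le[OF finI sub])
  also have "\<dots> = (\<Sum>ab\<in>?A \<times> ?B. card (?S ab))"
    by (rule card_SigmaI[OF finAB]) (use finS in blast)
  also have "\<dots> \<le> (\<Sum>ab\<in>?A \<times> ?B. nat (gcd m h))"
  proof (rule sum_mono)
    fix ab assume "ab \<in> ?A \<times> ?B"
    then obtain a b where ab: "ab = (a, b)" "0 < a" "a dvd m" "0 < b" "b dvd h" by auto
    have "int (card (?S ab)) \<le> gcd a (h div b)"
      using card_dvd_mult_le[OF ab(2), of "h div b"] by (simp add: ab(1))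
    also have "\<dots> \<le> gcd m h"
    proof (rule zdvd_imp_le)
      have "h div b dvd h" using ab by (metis dvd_div_mult_self dvd_triv_left)
      then show "gcd a (h div b) dvd gcd m h" using ab by (intro gcd_mono)
    qed (use assms in auto)
    finally show "card (?S ab) \<le> nat (gcd m h)" by simp
  qed
  also have "\<dots> = nat (gcd m h) * tau m * tau h"
    by (simp add: card_cartesian_product tau_def mult_ac)
  finally show "card \<K> \<le> nat (gcd m h) * tau m * tau h" .
qed

subsection \<open>Orthogonal pairs of integer vectors\<close>

type_synonym ivec = "int \<times> int \<times> int"

fun idot :: "ivec \<Rightarrow> ivec \<Rightarrow> int" where
  "idot (a, b, c) (a', b', c') = a * a' + b * b' + c * c'"

fun icross :: "ivec \<Rightarrow> ivec \<Rightarrow> ivec" where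
  "icross (a, b, c) (a', b', c') = (b * c' - c * b', c * a' - a * c', a * b' - b * a')"

fun iscale :: "int \<Rightarrow> ivec \<Rightarrow> ivec" where
  "iscale k (a, b, c) = (k * a, k * b, k * c)"

lemma idot_commute: "idot u v = idot v u"
  by (cases u; cases v) (simp add: mult.commute)

lemma idot_add_left: "idot (u + v) x = idot u x + idot v x"
  by (cases u; cases v; cases x) (simp add: algebra_simps)

lemma idot_diff_left: "idot (u - v) x = idot u x - idot v x"
  by (cases u; cases v; cases x) (simp add: algebra_simps)

lemma idot_iscale_left: "idot (iscale k u) x = k * idot u x"
  by (cases u; cases x) (simp add: algebra_simps)

lemmas idot_linear = idot_add_left idot_diff_left idot_iscale_left

lemma idot_icross_left: "idot (icross z d) z = 0" "idot (icross z d) d = 0"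
  by (cases z; cases d; simp add: algebra_simps)+

definition orth_pairs :: "int \<Rightarrow> int \<Rightarrow> (ivec \<times> ivec) set" where
  "orth_pairs m h = {(z, d). idot z z = m \<and> idot d d = h \<and> idot z d = 0}"

text \<open>By Bezout this is also the nonnegative generator of the ideal of all values
  \<open>idot v w\<close>, the form in which it is used.\<close>

definition vec_content :: "ivec \<Rightarrow> int" where
  "vec_content w = gcd (fst w) (gcd (fst (snd w)) (snd (snd w)))"

text \<open>\<open>dual_plane z d\<close> is the lattice plane orthogonal to \<open>z \<times> d\<close>, written in the coordinates
  given by pairing with \<open>z\<close> and \<open>d\<close>, which makes it comparable for different pairs.\<close>

definition dual_plane :: "ivec \<Rightarrow> ivec \<Rightarrow> (int \<times> int) set" where
  "dual_plane z d = {(idot v z, idot v d) | v. idot v (icross z d) = 0}"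

text \<open>The product of the determinants of \<open>(u, z, d)\<close> and \<open>(v, z, d)\<close> is a Gram determinant.\<close>

lemma gram_identity:
  assumes "(z, d) \<in> orth_pairs m h"
  shows "m * h * idot u v =
    h * idot u z * idot v z + m * idot u d * idot v d + idot u (icross z d) * idot v (icross z d)"
proof -
  obtain z1 z2 z3 d1 d2 d3 u1 u2 u3 v1 v2 v3 where
    eq: "z = (z1, z2, z3)" "d = (d1, d2, d3)" "u = (u1, u2, u3)" "v = (v1, v2, v3)"
    by (cases z; cases d; cases u; cases v) auto
  have "idot z z = m" "idot d d = h" "idot z d = 0" using assms by (auto simp: orth_pairs_def)
  \<comment> \<open>The expansion of the 3 by 3 Gram determinant along its first row holds for all
    vectors; orthogonality then removes the mixed terms.\<close>
  moreover have "idot u (icross z d) * idot v (icross z d) =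
      idot u v * (idot z z * idot d d - (idot z d)\<^sup>2)
      - idot u z * (idot v z * idot d d - idot z d * idot v d)
      + idot u d * (idot v z * idot z d - idot z z * idot v d)"
    unfolding eq idot.simps icross.simps power2_eq_square by (simp only: algebra_simps)
  ultimately show ?thesis by (simp add: algebra_simps)
qed

lemma vec_content_dvd_idot: "vec_content w dvd idot v w"
proof -
  obtain a b c v1 v2 v3 where eq: "w = (a, b, c)" "v = (v1, v2, v3)" by (cases w; cases v) auto
  have "vec_content w dvd a" "vec_content w dvd b" "vec_content w dvd c"
    unfolding vec_content_def eq fst_conv snd_conv
    by (rule gcd_dvd1 dvd_trans[OF gcd_dvd2 gcd_dvd1] dvd_trans[OF gcd_dvd2 gcd_dvd2])+
  then show ?thesis by (simp add: eq)
qed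

lemma vec_content_bezout: "\<exists>v. idot v w = vec_content w"
proof -
  obtain a b c where eq: "w = (a, b, c)" by (cases w) auto
  obtain x y where 1: "x * b + y * c = gcd b c" using bezout_int by blast
  obtain s t where 2: "s * a + t * gcd b c = gcd a (gcd b c)" using bezout_int by blast
  have "idot (s, t * x, t * y) w = s * a + t * (x * b + y * c)"
    by (simp add: eq algebra_simps)
  then show ?thesis using 1 2 by (auto simp: vec_content_def eq)
qed

lemma vec_content_quotient: "\<exists>c. w = iscale (vec_content w) c"
proof -
  obtain a b c where eq: "w = (a, b, c)" by (cases w) auto
  define k where "k = vec_content w"
  have "k dvd a" "k dvd b" "k dvd c"
    using vec_content_dvd_idot[of w "(1,0,0)"] vec_content_dvd_idot[of w "(0,1,0)"]
      vec_content_dvd_idot[of w "(0,0,1)"] unfolding k_def[symmetric] by (simp_all add: eq)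
  then obtain a' b' c' where "a = k * a'" "b = k * b'" "c = k * c'"
    by (auto elim!: dvdE)
  then have "w = iscale k (a', b', c')" by (simp add: eq)
  then show ?thesis unfolding k_def by blast
qed

text \<open>Lagrange's identity with vanishing mixed term.\<close>

lemma idot_icross_self:
  assumes "(z, d) \<in> orth_pairs m h"
  shows "idot (icross z d) (icross z d) = m * h"
proof -
  obtain z1 z2 z3 d1 d2 d3 where eq: "z = (z1, z2, z3)" "d = (d1, d2, d3)"
    by (cases z; cases d) auto
  have "idot z z = m" "idot d d = h" "idot z d = 0" using assms by (auto simp: orth_pairs_def)
  moreover have "idot (icross z d) (icross z d) = idot z z * idot d d - (idot z d)\<^sup>2"
    unfolding eq idot.simps icross.simps power2_eq_square by (simp only: algebra_simps)
  ultimately show ?thesis by simp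
qed

text \<open>Pulling the content out of both factors of \<open>idot w w = m * h\<close>, for
  \<open>w = icross z d\<close>, exhibits its square as a divisor; as \<open>m * h\<close> is
  nonzero, so is the content.\<close>

lemma vec_content_icross:
  assumes "(z, d) \<in> orth_pairs m h" "m > 0" "h > 0"
  shows "vec_content (icross z d) > 0" "(vec_content (icross z d))\<^sup>2 dvd m * h"
proof -
  obtain c where c: "icross z d = iscale (vec_content (icross z d)) c"
    using vec_content_quotient by blast
  have D: "m * h = (vec_content (icross z d))\<^sup>2 * idot c c"
  proof -
    have "idot (iscale k c) (iscale k c) = k\<^sup>2 * idot c c" for k
      by (cases c) (simp add: algebra_simps power2_eq_square)
    from this[of "vec_content (icross z d)"] show ?thesis
      unfolding c[symmetric] idot_icross_self[OF assms(1)] .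
  qed
  then show "(vec_content (icross z d))\<^sup>2 dvd m * h" by simp
  have "vec_content (icross z d) \<ge> 0" by (simp add: vec_content_def)
  moreover have "vec_content (icross z d) \<noteq> 0" using D assms(2,3) by auto
  ultimately show "vec_content (icross z d) > 0" by simp
qed

section \<open>The dual plane and the transport of integer vectors between pairs\<close>

lemma dual_plane_subgroup: "pair_subgroup (dual_plane z d)"
  unfolding pair_subgroup_def
proof (intro conjI ballI)
  show "(0, 0) \<in> dual_plane z d"
    unfolding dual_plane_def by (rule CollectI, rule exI[of _ "(0,0,0)"]) (cases z; cases d; simp)
  fix x y assume "x \<in> dual_plane z d" "y \<in> dual_plane z d"
  then obtain u v where "x = (idot u z, idot u d)" "idot u (icross z d) = 0"
    "y = (idot v z, idot v d)" "idot v (icross z d) = 0"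
    unfolding dual_plane_def by blast
  then show "x - y \<in> dual_plane z d"
    unfolding dual_plane_def
    by (intro CollectI exI[of _ "u - v"]) (simp add: idot_linear)
qed

text \<open>These are the coordinates of \<open>z\<close> and \<open>d\<close>, which themselves lie
  in the plane.\<close>

lemma dual_plane_contains:
  assumes "(z, d) \<in> orth_pairs m h"
  shows "(m, 0) \<in> dual_plane z d" "(0, h) \<in> dual_plane z d"
proof -
  have "idot z z = m" "idot d d = h" "idot z d = 0" using assms by (auto simp: orth_pairs_def)
  moreover have "idot z (icross z d) = 0" "idot d (icross z d) = 0" "idot d z = idot z d"
    using idot_icross_left[of z d] idot_commute by metis+
  ultimately have "m = idot z z \<and> 0 = idot z d \<and> idot z (icross z d) = 0"
    "0 = idot d z \<and> h = idot d d \<and> idot d (icross z d) = 0" by simp_all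
  then show "(m, 0) \<in> dual_plane z d" "(0, h) \<in> dual_plane z d"
    unfolding dual_plane_def by blast+
qed

text \<open>Over the rationals the vector with the prescribed coordinates is
  \<open>(v \<bullet> z / m) z0 + (v \<bullet> d / h) d0\<close>. It pairs integrally with the lattice plane orthogonal to
  \<open>z0 \<times> d0\<close>, because the pairing can be computed on the side of \<open>(z, d)\<close>; a multiple of
  \<open>z0 \<times> d0\<close> then corrects it to an integer vector.\<close>

lemma transport_coordinates:
  assumes "(z0, d0) \<in> orth_pairs m h" "(z, d) \<in> orth_pairs m h" "m > 0" "h > 0"
    and e0: "vec_content (icross z0 d0) = e"
    and K: "dual_plane z d = dual_plane z0 d0"
  shows "\<exists>u. idot u z0 = idot v z \<and> idot u d0 = idot v d"
proof -
  let ?w = "icross z0 d0"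
  have e: "e > 0" using vec_content_icross(1)[OF assms(1,3,4)] e0 by simp
  obtain v0 where v0: "idot v0 ?w = e" using vec_content_bezout e0 by metis
  obtain c where c: "?w = iscale e c" using vec_content_quotient e0 by metis
  have cz: "idot c z0 = 0" "idot c d0 = 0"
    using idot_icross_left[of z0 d0] e unfolding c idot_iscale_left by auto
  have cv: "idot c v0 = 1"
    using v0 e unfolding c idot_commute[of v0 "iscale e c"] idot_iscale_left by simp
  \<comment> \<open>Equality of the dual planes supplies \<open>y\<close> on the side of
    \<open>(z, d)\<close> with the coordinates of \<open>x\<close>; the Gram identity then gives
    \<open>r = idot v y\<close>, an integer.\<close>
  have F: "\<exists>r. m * h * r = h * idot v z * idot x z0 + m * idot v d * idot x d0"
    if x: "idot x ?w = 0" for x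
  proof -
    have "(idot x z0, idot x d0) \<in> dual_plane z0 d0" unfolding dual_plane_def using x by blast
    then have "(idot x z0, idot x d0) \<in> dual_plane z d" using K by simp
    then obtain y where y: "idot y z = idot x z0" "idot y d = idot x d0" "idot y (icross z d) = 0"
      unfolding dual_plane_def by auto
    show ?thesis using gram_identity[OF assms(2), of v y] y by auto
  qed
  obtain z1 z2 z3 d1 d2 d3 c1 c2 c3 where eq: "z0 = (z1, z2, z3)" "d0 = (d1, d2, d3)" "c = (c1, c2, c3)"
    by (cases z0; cases d0; cases c) auto
  define p0 q0 where "p0 = idot v0 z0" and "q0 = idot v0 d0"
  \<comment> \<open>An arbitrary \<open>x\<close> is projected into the plane along
    \<open>v0\<close>: as \<open>idot x ?w = e * idot x c\<close> and \<open>idot v0 ?w = e\<close>,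
    subtracting \<open>idot x c\<close> copies of \<open>v0\<close> suffices.\<close>
  have ex: "\<exists>r. m * h * r = h * idot v z * (idot x z0 - idot x c * p0) + m * idot v d * (idot x d0 - idot x c * q0)" for x
  proof -
    have "idot (x - iscale (idot x c) v0) ?w = 0"
      using v0 idot_commute[of x c]
      by (simp add: idot_linear) (simp add: c idot_commute[of x "iscale e c"] idot_iscale_left)
    from F[OF this] show ?thesis by (simp add: idot_linear p0_def q0_def)
  qed
  \<comment> \<open>The values at the standard basis vectors are the coordinates of the desired
    \<open>u\<close>. The terms with \<open>c\<close> drop out on pairing with \<open>z0\<close> or
    \<open>d0\<close>, because \<open>c\<close> is orthogonal to both.\<close>
  from ex[of "(1,0,0)"] obtain r1 where r1:
    "m * h * r1 = h * idot v z * (z1 - c1 * p0) + m * idot v d * (d1 - c1 * q0)" by (auto simp: eq)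
  from ex[of "(0,1,0)"] obtain r2 where r2:
    "m * h * r2 = h * idot v z * (z2 - c2 * p0) + m * idot v d * (d2 - c2 * q0)" by (auto simp: eq)
  from ex[of "(0,0,1)"] obtain r3 where r3:
    "m * h * r3 = h * idot v z * (z3 - c3 * p0) + m * idot v d * (d3 - c3 * q0)" by (auto simp: eq)
  have zz: "z1 * z1 + z2 * z2 + z3 * z3 = m" "d1 * d1 + d2 * d2 + d3 * d3 = h"
    "z1 * d1 + z2 * d2 + z3 * d3 = 0" using assms(1) by (auto simp: orth_pairs_def eq)
  have cc: "c1 * z1 + c2 * z2 + c3 * z3 = 0" "c1 * d1 + c2 * d2 + c3 * d3 = 0"
    using cz by (auto simp: eq)
  have "m * h * idot (r1, r2, r3) z0 = (m * h * r1) * z1 + (m * h * r2) * z2 + (m * h * r3) * z3"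
    unfolding eq idot.simps by (simp only: algebra_simps)
  also have "\<dots> = h * idot v z * ((z1 * z1 + z2 * z2 + z3 * z3) - p0 * (c1 * z1 + c2 * z2 + c3 * z3))
      + m * idot v d * ((z1 * d1 + z2 * d2 + z3 * d3) - q0 * (c1 * z1 + c2 * z2 + c3 * z3))"
    unfolding r1 r2 r3 by (simp only: algebra_simps)
  also have "\<dots> = m * h * idot v z" unfolding zz cc by simp
  finally have rz: "m * h * idot (r1, r2, r3) z0 = m * h * idot v z" .
  have "m * h * idot (r1, r2, r3) d0 = (m * h * r1) * d1 + (m * h * r2) * d2 + (m * h * r3) * d3"
    unfolding eq idot.simps by (simp only: algebra_simps)
  also have "\<dots> = h * idot v z * ((z1 * d1 + z2 * d2 + z3 * d3) - p0 * (c1 * d1 + c2 * d2 + c3 * d3))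
      + m * idot v d * ((d1 * d1 + d2 * d2 + d3 * d3) - q0 * (c1 * d1 + c2 * d2 + c3 * d3))"
    unfolding r1 r2 r3 by (simp only: algebra_simps)
  also have "\<dots> = m * h * idot v d" unfolding zz cc by simp
  finally have "m * h * idot (r1, r2, r3) d0 = m * h * idot v d" .
  then have "idot (r1, r2, r3) d0 = idot v d" using assms(3,4) by simp
  moreover have "idot (r1, r2, r3) z0 = idot v z" using rz assms(3,4) by simp
  ultimately show ?thesis by blast
qed

text \<open>The multiplier is \<open>k = idot u ?w / e\<close>, where \<open>u\<close> has the
  coordinates of \<open>v\<close> along \<open>z0\<close> and \<open>d0\<close>; then
  \<open>u - k v0\<close> lies in the dual plane. It is a square root of one because
  \<open>u\<close> and \<open>v\<close> both have integral norm.\<close>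

lemma glue_multiplier:
  assumes "(z0, d0) \<in> orth_pairs m h" "(z, d) \<in> orth_pairs m h" "m > 0" "h > 0"
    and e: "vec_content (icross z0 d0) = e" "vec_content (icross z d) = e"
    and K: "dual_plane z0 d0 = K" "dual_plane z d = K"
    and v: "idot v0 (icross z0 d0) = e" "idot v (icross z d) = e"
    and N: "m * h = e\<^sup>2 * N"
  shows "\<exists>k\<in>{0..<N}. N dvd k\<^sup>2 - 1 \<and> (idot v z - k * idot v0 z0, idot v d - k * idot v0 d0) \<in> K"
proof -
  let ?w = "icross z0 d0"
  have epos: "e > 0" using vec_content_icross(1)[OF assms(1,3,4)] e by simp
  have "m * h > 0" using assms(3,4) by simp
  then have Npos: "N > 0" using N epos by (simp add: zero_less_mult_iff)
  obtain u where u: "idot u z0 = idot v z" "idot u d0 = idot v d"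
    using transport_coordinates[OF assms(1-4) e(1)] K by metis
  obtain k where k: "idot u ?w = e * k" using vec_content_dvd_idot[of ?w u] e(1) by auto
  have mem: "(idot v z - k * idot v0 z0, idot v d - k * idot v0 d0) \<in> K"
    unfolding K(1)[symmetric] dual_plane_def
    by (rule CollectI, rule exI[of _ "u - iscale k v0"]) (simp add: idot_linear u k v)
  \<comment> \<open>The Gram identity is applied to both vectors; their norms differ only through
    the third coordinate, \<open>e\<close> against \<open>e * k\<close>.\<close>
  have "m * h * idot v v = h * idot v z * idot v z + m * idot v d * idot v d + e * e"
    using gram_identity[OF assms(2), of v v] v by simp
  moreover have "m * h * idot u u = h * idot v z * idot v z + m * idot v d * idot v d + (e * k) * (e * k)"
    using gram_identity[OF assms(1), of u u] u k by simp
  ultimately have "m * h * (idot u u - idot v v) = e\<^sup>2 * (k\<^sup>2 - 1)"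
    by (simp add: algebra_simps power2_eq_square)
  then have "e\<^sup>2 * (N * (idot u u - idot v v)) = e\<^sup>2 * (k\<^sup>2 - 1)" unfolding N by (simp only: mult.assoc)
  then have "k\<^sup>2 - 1 = N * (idot u u - idot v v)" using epos by simp
  then have sq: "N dvd k\<^sup>2 - 1" by simp
  obtain c where c: "?w = iscale e c" using vec_content_quotient e(1) by metis
  have cz: "idot c z0 = 0" "idot c d0 = 0"
    using idot_icross_left[of z0 d0] epos unfolding c idot_iscale_left by auto
  have "e * idot c ?w = m * h"
    using idot_icross_self[OF assms(1)] by (metis c idot_iscale_left)
  then have "e * idot c ?w = e * (e * N)" using N by (simp add: power2_eq_square)
  then have cw: "idot c ?w = e * N" using epos by simp
  \<comment> \<open>Since \<open>N v0 - c\<close> lies in the plane, multiples of \<open>N\<close>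
    can be subtracted from \<open>k\<close>, which brings the multiplier into
    \<open>{0..<N}\<close>.\<close>
  have "(N * idot v0 z0, N * idot v0 d0) \<in> K"
    unfolding K(1)[symmetric] dual_plane_def
    by (rule CollectI, rule exI[of _ "iscale N v0 - c"]) (simp add: idot_linear cz cw v)
  then have "((k div N) * (N * idot v0 z0), (k div N) * (N * idot v0 d0)) \<in> K"
    using pair_subgroup_scale[of K] dual_plane_subgroup[of z0 d0] K(1) by blast
  then have "(idot v z - k * idot v0 z0, idot v d - k * idot v0 d0)
     + ((k div N) * (N * idot v0 z0), (k div N) * (N * idot v0 d0)) \<in> K"
    using pair_subgroup_add[of K] dual_plane_subgroup[of z0 d0] K(1) mem by blast
  then have "(idot v z - (k - k div N * N) * idot v0 z0, idot v d - (k - k div N * N) * idot v0 d0) \<in> K"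
    by (simp add: algebra_simps)
  then have "(idot v z - k mod N * idot v0 z0, idot v d - k mod N * idot v0 d0) \<in> K"
    by (simp only: minus_div_mult_eq_mod)
  moreover have "N dvd (k mod N)\<^sup>2 - 1"
  proof -
    have "N dvd k\<^sup>2 - (k mod N)\<^sup>2"
      by (simp add: mod_eq_dvd_iff[symmetric] power_mod)
    from dvd_diff[OF sq this] show ?thesis by simp
  qed
  ultimately show ?thesis using Npos by (intro bexI[of _ "k mod N"]) auto
qed

text \<open>Applied to the standard basis vectors, this says that \<open>(z, d)\<close> arises from \<open>(z0, d0)\<close> by a
  signed permutation of the coordinates.\<close>

lemma transport_vector:
  assumes "(z0, d0) \<in> orth_pairs m h" "(z, d) \<in> orth_pairs m h" "m > 0" "h > 0"
    and e: "vec_content (icross z0 d0) = e" "vec_content (icross z d) = e"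
    and K: "dual_plane z0 d0 = K" "dual_plane z d = K"
    and v: "idot v0 (icross z0 d0) = e" "idot v (icross z d) = e"
    and mem: "(idot v z - idot v0 z0, idot v d - idot v0 d0) \<in> K"
  shows "\<exists>y. idot y z0 = idot x z \<and> idot y d0 = idot x d \<and> idot y y = idot x x"
proof -
  obtain c where c: "idot x (icross z d) = e * c" using vec_content_dvd_idot[of "icross z d" x] e(2) by auto
  have "(idot (x - iscale c v) z, idot (x - iscale c v) d) \<in> K"
    unfolding K(2)[symmetric] dual_plane_def
    by (rule CollectI, rule exI[of _ "x - iscale c v"]) (simp add: idot_linear c v)
  then obtain l where l: "idot l z0 = idot (x - iscale c v) z" "idot l d0 = idot (x - iscale c v) d"
    "idot l (icross z0 d0) = 0" unfolding K(1)[symmetric] dual_plane_def by auto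
  \<comment> \<open>The vector \<open>v0 + g\<close> has all three coordinates of \<open>v\<close>.
    As \<open>x\<close> is \<open>c v\<close> plus a plane vector, \<open>y\<close> is the same
    combination on the other side; equal coordinates give equal norms.\<close>
  obtain g where g: "idot g z0 = idot v z - idot v0 z0" "idot g d0 = idot v d - idot v0 d0"
    "idot g (icross z0 d0) = 0" using mem unfolding K(1)[symmetric] dual_plane_def by auto
  define y where "y = iscale c (v0 + g) + l"
  have y: "idot y z0 = idot x z" "idot y d0 = idot x d" "idot y (icross z0 d0) = idot x (icross z d)"
    by (simp_all add: y_def idot_linear l g v c)
  have "m * h * idot y y = m * h * idot x x"
    using gram_identity[OF assms(1), of y y] gram_identity[OF assms(2), of x x] y by simp
  then have "idot y y = idot x x" using assms(3,4) by simp
  then show ?thesis using y by blast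
qed

definition unit_vecs :: "ivec set" where
  "unit_vecs = {(1,0,0), (-1,0,0), (0,1,0), (0,-1,0), (0,0,1), (0,0,-1)}"

lemma int_square_le_one: "(a::int) * a \<le> 1 \<Longrightarrow> a = 0 \<or> a = 1 \<or> a = -1"
proof -
  assume "a * a \<le> 1"
  then have "a\<^sup>2 \<le> 1\<^sup>2" by (simp add: power2_eq_square)
  then have "\<bar>a\<bar> \<le> 1" using abs_le_square_iff[of a 1] by simp
  then show ?thesis by linarith
qed

lemma idot_self_eq_one: "idot y y = 1 \<Longrightarrow> y \<in> unit_vecs"
proof -
  assume y: "idot y y = 1"
  obtain a b c where eq: "y = (a, b, c)" by (cases y) auto
  have s: "a * a + b * b + c * c = 1" using y eq by simp
  have "a * a \<ge> 0" "b * b \<ge> 0" "c * c \<ge> 0" by auto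
  then have "a * a \<le> 1" "b * b \<le> 1" "c * c \<le> 1" using s by linarith+
  then have "a = 0 \<or> a = 1 \<or> a = -1" "b = 0 \<or> b = 1 \<or> b = -1" "c = 0 \<or> c = 1 \<or> c = -1"
    using int_square_le_one by blast+
  then show ?thesis using s unfolding eq unit_vecs_def by (elim disjE) simp_all
qed

text \<open>Transport turns the three standard basis vectors into integer vectors of norm one, whose
  pairings with \<open>z0\<close> and \<open>d0\<close> recover \<open>z\<close> and
  \<open>d\<close>. Each has 6 choices, and \<open>216 = 6 ^ 3\<close>.\<close>

lemma card_same_glue_le:
  assumes "(z0, d0) \<in> orth_pairs m h" "m > 0" "h > 0"
    and e: "vec_content (icross z0 d0) = e" and K: "dual_plane z0 d0 = K"
    and v: "idot v0 (icross z0 d0) = e"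
    and T: "\<And>z d. (z, d) \<in> T \<Longrightarrow> (z, d) \<in> orth_pairs m h \<and> vec_content (icross z d) = e \<and>
        dual_plane z d = K \<and>
        (\<exists>v. idot v (icross z d) = e \<and> (idot v z - idot v0 z0, idot v d - idot v0 d0) \<in> K)"
  shows "card T \<le> 216"
proof -
  let ?U = "unit_vecs \<times> unit_vecs \<times> unit_vecs"
  let ?f = "\<lambda>(x, y, t). ((idot x z0, idot y z0, idot t z0), (idot x d0, idot y d0, idot t d0))"
  have fin: "finite ?U" by (simp add: unit_vecs_def)
  have "T \<subseteq> ?f ` ?U"
  proof
    fix zd assume "zd \<in> T"
    then obtain z d v where zd: "zd = (z, d)" "(z, d) \<in> orth_pairs m h" "vec_content (icross z d) = e"
        "dual_plane z d = K" "idot v (icross z d) = e"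
        "(idot v z - idot v0 z0, idot v d - idot v0 d0) \<in> K"
      using T[of "fst zd" "snd zd"] by (metis prod.collapse)
    obtain z1 z2 z3 d1 d2 d3 where eq: "z = (z1, z2, z3)" "d = (d1, d2, d3)" by (cases z; cases d) auto
    note tr = transport_vector[OF assms(1) zd(2) assms(2,3) e zd(3) K zd(4) v zd(5,6)]
    obtain y1 where "idot y1 z0 = z1 \<and> idot y1 d0 = d1 \<and> idot y1 y1 = 1"
      using tr[of "(1,0,0)"] by (auto simp: eq)
    moreover obtain y2 where "idot y2 z0 = z2 \<and> idot y2 d0 = d2 \<and> idot y2 y2 = 1"
      using tr[of "(0,1,0)"] by (auto simp: eq)
    moreover obtain y3 where "idot y3 z0 = z3 \<and> idot y3 d0 = d3 \<and> idot y3 y3 = 1"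
      using tr[of "(0,0,1)"] by (auto simp: eq)
    ultimately show "zd \<in> ?f ` ?U"
      by (intro image_eqI[of _ _ "(y1, y2, y3)"]) (auto simp: zd(1) eq idot_self_eq_one)
  qed
  then have "card T \<le> card ?U" by (rule surj_card_le[OF fin])
  also have "card ?U = card unit_vecs * (card unit_vecs * card unit_vecs)"
    by (simp add: card_cartesian_product)
  also have "card unit_vecs = 6" by (simp add: unit_vecs_def)
  finally show ?thesis by simp
qed

lemma finite_idot_le: "finite {v. idot v v \<le> m}"
proof (rule finite_subset)
  show "{v. idot v v \<le> m} \<subseteq> {-m..m} \<times> {-m..m} \<times> {-m..m}"
  proof
    fix v assume v: "v \<in> {v. idot v v \<le> m}"
    obtain a b c where eq: "v = (a, b, c)" by (cases v) auto
    have s: "a * a + b * b + c * c \<le> m" using v eq by simp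
    have sq: "\<bar>x\<bar> \<le> x * x" for x :: int
    proof (cases "x = 0")
      case False
      then have "\<bar>x\<bar> * 1 \<le> \<bar>x\<bar> * \<bar>x\<bar>" by (intro mult_left_mono) auto
      then show ?thesis by simp
    qed simp
    have "a * a \<ge> 0" "b * b \<ge> 0" "c * c \<ge> 0" by auto
    then have "\<bar>a\<bar> \<le> m" "\<bar>b\<bar> \<le> m" "\<bar>c\<bar> \<le> m" using s sq[of a] sq[of b] sq[of c] by linarith+
    then show "v \<in> {-m..m} \<times> {-m..m} \<times> {-m..m}" by (auto simp: eq abs_le_iff)
  qed
qed auto

section \<open>Counting orthogonal pairs with prescribed norms\<close>

lemma finite_orth_pairs: "finite (orth_pairs m h)"
  by (rule finite_subset[of _ "{v. idot v v \<le> m} \<times> {v. idot v v \<le> h}"])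
    (auto simp: orth_pairs_def finite_idot_le)

lemma card_le_fibres:
  assumes "finite A" "finite B" "f ` A \<subseteq> B" "\<And>y. y \<in> B \<Longrightarrow> card {x\<in>A. f x = y} \<le> c"
  shows "card A \<le> c * card B"
proof -
  have "card A = (\<Sum>y\<in>f ` A. card {x\<in>A. f x = y})"
    using sum.image_gen[OF assms(1), of "\<lambda>_. 1::nat" f] by simp
  also have "\<dots> \<le> (\<Sum>y\<in>f ` A. c)" using assms by (intro sum_mono) auto
  also have "\<dots> = c * card (f ` A)" by simp
  also have "\<dots> \<le> c * card B" using assms by (intro mult_le_mono2 card_mono)
  finally show ?thesis .
qed

text \<open>Pairs are sorted by their multiplier relative to one reference pair. There are at most
  \<open>2 * tau N\<close> multipliers, and each fibre has at most 216 elements.\<close>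

lemma card_same_plane_le:
  assumes "m > 0" "h > 0"
  shows "card {(z, d) \<in> orth_pairs m h. vec_content (icross z d) = e \<and> dual_plane z d = K}
    \<le> 216 * (2 * tau (m * h))" (is "card ?S \<le> _")
proof (cases "?S = {}")
  case True
  then show ?thesis by (metis card.empty zero_le)
next
  case False
  then obtain z0 d0 where zd0: "(z0, d0) \<in> orth_pairs m h" "vec_content (icross z0 d0) = e"
    "dual_plane z0 d0 = K" by auto
  have finS: "finite ?S" by (rule finite_subset[OF _ finite_orth_pairs[of m h]]) auto
  have e: "e > 0" "e\<^sup>2 dvd m * h" using vec_content_icross[OF zd0(1) assms] zd0(2) by auto
  obtain N where N: "m * h = e\<^sup>2 * N" using e by auto
  have D: "m * h > 0" using assms by simp
  then have Npos: "N > 0" using N e by (simp add: zero_less_mult_iff)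
  \<comment> \<open>One glue vector is fixed for every pair, so that multipliers of different pairs
    are comparable.\<close>
  obtain v where v: "\<And>z d. idot (v (z, d)) (icross z d) = vec_content (icross z d)"
  proof -
    define v where "v = (\<lambda>(z, d). SOME v. idot v (icross z d) = vec_content (icross z d))"
    have "idot (v (z, d)) (icross z d) = vec_content (icross z d)" for z d
      unfolding v_def prod.case using vec_content_bezout by (rule someI_ex)
    then show ?thesis using that by blast
  qed
  let ?R = "{k\<in>{0..<N}. N dvd k\<^sup>2 - 1}"
  let ?P = "\<lambda>(z, d) k. k \<in> ?R \<and>
     (idot (v (z, d)) z - k * idot (v (z0, d0)) z0, idot (v (z, d)) d - k * idot (v (z0, d0)) d0) \<in> K"
  define f where "f zd = (SOME k. ?P zd k)" for zd
  have f: "?P (z, d) (f (z, d))" if "(z, d) \<in> ?S" for z d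
  proof -
    have zd: "(z, d) \<in> orth_pairs m h" "vec_content (icross z d) = e" "dual_plane z d = K"
      using that by auto
    have "idot (v (z0, d0)) (icross z0 d0) = e" "idot (v (z, d)) (icross z d) = e"
      using v zd0(2) zd(2) by auto
    from glue_multiplier[OF zd0(1) zd(1) assms zd0(2) zd(2) zd0(3) zd(3) this N]
    have "\<exists>k. ?P (z, d) k" unfolding prod.case by blast
    then show ?thesis unfolding f_def by (rule someI_ex)
  qed
  have finR: "finite ?R" by (rule finite_subset[of _ "{0..<N}"]) auto
  have "card ?S \<le> 216 * card ?R"
  proof (rule card_le_fibres[OF finS finR, of f])
    show "f ` ?S \<subseteq> ?R" using f by fastforce
    fix k
    show "card {x \<in> ?S. f x = k} \<le> 216" (is "card ?T \<le> _")
    proof (cases "?T = {}")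
      case True
      then show ?thesis by (metis card.empty zero_le)
    next
      case False
      \<comment> \<open>A pair of the fibre becomes the new reference: subtracting two memberships
        with the same \<open>k\<close> cancels the terms of \<open>(z0, d0)\<close>, so that the
        multiplier becomes one.\<close>
      then obtain z1 d1 where zd1: "(z1, d1) \<in> ?T" by auto
      then have S1: "(z1, d1) \<in> orth_pairs m h" "vec_content (icross z1 d1) = e" "dual_plane z1 d1 = K"
        by auto
      have v1: "idot (v (z1, d1)) (icross z1 d1) = e" using v S1 by simp
      show ?thesis
      proof (rule card_same_glue_le[OF S1(1) assms S1(2,3) v1])
        fix z d assume zd: "(z, d) \<in> ?T"
        then have S: "(z, d) \<in> orth_pairs m h" "vec_content (icross z d) = e" "dual_plane z d = K"
          by auto
        have a: "(idot (v (z, d)) z - k * idot (v (z0, d0)) z0,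
            idot (v (z, d)) d - k * idot (v (z0, d0)) d0) \<in> K"
          using f[of z d] zd by auto
        have b: "(idot (v (z1, d1)) z1 - k * idot (v (z0, d0)) z0,
            idot (v (z1, d1)) d1 - k * idot (v (z0, d0)) d0) \<in> K"
          using f[of z1 d1] zd1 by auto
        have "pair_subgroup K" using dual_plane_subgroup[of z d] S(3) by simp
        from pair_subgroup_minus[OF this a b]
        have "(idot (v (z, d)) z - idot (v (z1, d1)) z1, idot (v (z, d)) d - idot (v (z1, d1)) d1) \<in> K"
          by simp
        then show "(z, d) \<in> orth_pairs m h \<and> vec_content (icross z d) = e \<and> dual_plane z d = K \<and>
          (\<exists>u. idot u (icross z d) = e \<and>
            (idot u z - idot (v (z1, d1)) z1, idot u d - idot (v (z1, d1)) d1) \<in> K)"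
          using S v[of z d] by (intro conjI exI[of _ "v (z, d)"]) simp_all
      qed
    qed
  qed
  also have "card ?R \<le> 2 * tau N" by (rule card_square_roots_of_one_le[OF Npos])
  also have "tau N \<le> tau (m * h)" by (rule tau_mono[OF _ D]) (simp add: N)
  finally show ?thesis by simp
qed

text \<open>Pairs are classified by content and dual plane. One factor \<open>tau (m * h)\<close>
  counts contents, the other bounds the square roots of one; \<open>432 = 216 * 2\<close>.\<close>

lemma card_orth_pairs_le:
  assumes "m > 0" "h > 0"
  shows "card (orth_pairs m h) \<le> 432 * nat (gcd m h) * tau m * tau h * (tau (m * h))\<^sup>2"
proof -
  define E where "E = {e. 0 < e \<and> e dvd m * h}"
  define \<K> where "\<K> = {K. pair_subgroup K \<and> (m, 0) \<in> K \<and> (0, h) \<in> K}"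
  define f where "f = (\<lambda>x. (vec_content (icross (fst x) (snd x)), dual_plane (fst x) (snd x)))"
  have D: "m * h > 0" using assms by simp
  have finEK: "finite (E \<times> \<K>)"
    using finite_pos_divisors[OF D] card_subgroups_le(1)[OF assms] by (simp add: E_def \<K>_def)
  have sub: "f ` orth_pairs m h \<subseteq> E \<times> \<K>"
  proof (rule image_subsetI)
    fix x assume x: "x \<in> orth_pairs m h"
    define z d where "z = fst x" and "d = snd x"
    have zd: "(z, d) \<in> orth_pairs m h" using x by (simp add: z_def d_def)
    have "vec_content (icross z d) dvd (vec_content (icross z d))\<^sup>2"
      by (simp add: power2_eq_square)
    then have "vec_content (icross z d) dvd m * h"
      using vec_content_icross(2)[OF zd assms] by (rule dvd_trans)
    then have "vec_content (icross z d) \<in> E"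
      using vec_content_icross(1)[OF zd assms] by (simp add: E_def)
    moreover have "dual_plane z d \<in> \<K>"
      using dual_plane_subgroup dual_plane_contains[OF zd] by (simp add: \<K>_def)
    ultimately show "f x \<in> E \<times> \<K>" by (simp add: f_def z_def d_def)
  qed
  have fibre: "card {x \<in> orth_pairs m h. f x = y} \<le> 216 * (2 * tau (m * h))" for y
  proof -
    have "{x \<in> orth_pairs m h. f x = y} =
        {(z, d) \<in> orth_pairs m h. vec_content (icross z d) = fst y \<and> dual_plane z d = snd y}"
      by (auto simp: f_def)
    then show ?thesis
      using card_same_plane_le[OF assms, of "fst y" "snd y"] by simp
  qed
  have "card (orth_pairs m h) \<le> (216 * (2 * tau (m * h))) * card (E \<times> \<K>)"
    using card_le_fibres[OF finite_orth_pairs finEK sub] fibre by simp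
  also have "card (E \<times> \<K>) = tau (m * h) * card \<K>"
    by (simp add: card_cartesian_product tau_def E_def)
  also have "216 * (2 * tau (m * h)) * (tau (m * h) * card \<K>)
      \<le> 216 * (2 * tau (m * h)) * (tau (m * h) * (nat (gcd m h) * tau m * tau h))"
    using card_subgroups_le(2)[OF assms] unfolding \<K>_def by (intro mult_le_mono2)
  also have "\<dots> = 432 * nat (gcd m h) * tau m * tau h * (tau (m * h))\<^sup>2"
    by (simp add: power2_eq_square)
  finally show ?thesis .
qed

section \<open>The average of greatest common divisors\<close>

text \<open>The gcd is at most the sum of all common divisors \<open>g\<close>; after exchanging the
  sums each \<open>g\<close> contributes \<open>(H div g) * g \<le> H\<close>.\<close>

lemma sum_gcd_le:
  fixes M H :: int
  assumes "M > 0" "H \<ge> 0"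
  shows "(\<Sum>h\<in>{1..H}. gcd M h) \<le> H * int (tau M)"
proof -
  let ?G = "{g. 0 < g \<and> g dvd M}"
  have fin: "finite ?G" by (rule finite_pos_divisors[OF assms(1)])
  have "(\<Sum>h\<in>{1..H}. gcd M h) \<le> (\<Sum>h\<in>{1..H}. \<Sum>g\<in>?G. if g dvd h then g else 0)"
  proof (rule sum_mono)
    fix h assume "h \<in> {1..H}"
    have "(if gcd M h dvd h then gcd M h else 0) \<le> (\<Sum>g\<in>?G. if g dvd h then g else 0)"
      using assms by (intro member_le_sum[OF _ _ fin]) auto
    then show "gcd M h \<le> (\<Sum>g\<in>?G. if g dvd h then g else 0)" by simp
  qed
  also have "\<dots> = (\<Sum>g\<in>?G. \<Sum>h\<in>{1..H}. if g dvd h then g else 0)" by (rule sum.swap)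
  also have "\<dots> \<le> (\<Sum>g\<in>?G. H)"
  proof (rule sum_mono)
    fix g assume "g \<in> ?G"
    then have g: "g > 0" by simp
    have "(\<Sum>h\<in>{1..H}. if g dvd h then g else 0) = (\<Sum>h\<in>{h\<in>{1..H}. g dvd h}. g)"
      by (rule sum.inter_filter[symmetric]) simp
    also have "\<dots> = int (card {h\<in>{1..H}. g dvd h}) * g" by simp
    also have "\<dots> \<le> (H div g) * g"
    proof (rule mult_right_mono)
      have "{h\<in>{1..H}. g dvd h} \<subseteq> (\<lambda>j. g * j) ` {1..H div g}"
      proof
        fix h assume h: "h \<in> {h\<in>{1..H}. g dvd h}"
        then obtain j where j: "h = g * j" by auto
        have "0 < g * j" using h j by simp
        then have "j \<ge> 1" using g by (simp add: zero_less_mult_iff)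
        moreover have "j \<le> H div g"
          using zdiv_mono1[of h H g] h g j by simp
        ultimately show "h \<in> (\<lambda>j. g * j) ` {1..H div g}" using j by (intro image_eqI[of _ _ j]) auto
      qed
      then have "card {h\<in>{1..H}. g dvd h} \<le> card {1..H div g}"
        by (rule surj_card_le[rotated]) simp
      moreover have "H div g \<ge> 0" using assms(2) g by (simp add: pos_imp_zdiv_nonneg_iff)
      ultimately show "int (card {h\<in>{1..H}. g dvd h}) \<le> H div g" by simp
    qed (use g in simp)
    also have "\<dots> \<le> H"
    proof -
      have "H div g * g + H mod g = H" by simp
      moreover have "H mod g \<ge> 0" using g by simp
      ultimately show ?thesis by linarith
    qed
    finally show "(\<Sum>h\<in>{1..H}. if g dvd h then g else 0) \<le> H" .
  qed
  also have "\<dots> = H * int (tau M)" by (simp add: tau_def)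
  finally show ?thesis .
qed

subsection \<open>Close pairs on the sphere\<close>

definition int_sphere :: "nat \<Rightarrow> ivec set" where
  "int_sphere n = {v. idot v v = int n}"

lemma finite_int_sphere: "finite (int_sphere n)"
  by (rule finite_subset[OF _ finite_idot_le[of "int n"]]) (auto simp: int_sphere_def)

lemma idot_self_nonneg: "idot v v \<ge> 0"
  by (cases v) simp

lemma idot_self_eq_0: "idot v v = 0 \<longleftrightarrow> v = (0, 0, 0)"
proof -
  obtain a b c where eq: "v = (a, b, c)" by (cases v) auto
  have "a * a \<ge> 0" "b * b \<ge> 0" "c * c \<ge> 0" by auto
  then have "a * a + b * b + c * c = 0 \<longleftrightarrow> a * a = 0 \<and> b * b = 0 \<and> c * c = 0" by linarith
  then show ?thesis by (simp add: eq)
qed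

text \<open>A uniform divisor bound \<open>T\<close> hides the epsilon powers. The range
  \<open>16 n^2\<close> covers products \<open>m * h\<close> with both factors at most
  \<open>4 n\<close>.\<close>

locale tau_bounded =
  fixes n :: nat and T :: real
  assumes n: "n \<ge> 1" and T1: "T \<ge> 1"
    and tau_le: "\<And>k. 0 < k \<Longrightarrow> k \<le> 16 * int n * int n \<Longrightarrow> real (tau k) \<le> T"
begin

lemma orth_pairs_bound:
  assumes "0 < m" "m \<le> 4 * int n" "0 < h" "h \<le> 4 * int n"
  shows "real (card (orth_pairs m h)) \<le> 432 * of_int (gcd m h) * T ^ 4"
proof -
  have le: "4 * int n \<le> 16 * int n * int n" using n by simp
  have "m * h \<le> (4 * int n) * (4 * int n)" using assms by (intro mult_mono) auto
  then have mh: "real (tau (m * h)) \<le> T" using assms by (intro tau_le) auto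
  have t: "real (tau m) \<le> T" "real (tau h) \<le> T" 
    using assms le by (intro tau_le; linarith)+
  have "real (card (orth_pairs m h)) \<le>
      real (432 * nat (gcd m h) * tau m * tau h * (tau (m * h))\<^sup>2)"
    using card_orth_pairs_le[OF assms(1,3)] by (simp only: of_nat_le_iff)
  also have "\<dots> = 432 * of_int (gcd m h) * (real (tau m) * real (tau h) * (real (tau (m * h)))\<^sup>2)"
    by simp
  also have "\<dots> \<le> 432 * of_int (gcd m h) * (T * T * T\<^sup>2)"
    using t mh T1 by (intro mult_left_mono mult_mono power_mono) auto
  also have "T * T * T\<^sup>2 = T ^ 4" by (simp add: power2_eq_square power4_eq_xxxx)
  finally show ?thesis .
qed

text \<open>Points of a planar circle become orthogonal pairs together with the vector \<open>(1, 0, 0)\<close>.\<close>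

lemma card_sphere_slice_le:
  "real (card {v \<in> int_sphere n. fst v = a}) \<le> 432 * T ^ 4"
proof -
  let ?S = "{v \<in> int_sphere n. fst v = a}"
  have T4: "1 \<le> 432 * T ^ 4" using one_le_power[OF T1, of 4] by linarith
  have sub: "idot (0, snd v) (0, snd v) = int n - a * a" if "v \<in> ?S" for v
    using that by (cases v) (auto simp: int_sphere_def)
  consider "?S = {}" | "?S \<noteq> {}" "int n - a * a = 0" | "?S \<noteq> {}" "int n - a * a > 0"
  proof (cases "?S = {}")
    case True
    then show thesis by (rule that(1))
  next
    case False
    then obtain v where "v \<in> ?S" by blast
    then have "int n - a * a \<ge> 0" using sub[of v] idot_self_nonneg[of "(0, snd v)"] by linarith
    then have "int n - a * a = 0 \<or> int n - a * a > 0" by linarith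
    then show thesis using that(2,3) False by blast
  qed
  then show ?thesis
  proof cases
    case 1
    have "0 \<le> 432 * T ^ 4" using T4 by linarith
    then show ?thesis unfolding 1 by simp
  next
    case 2
    have "?S \<subseteq> {(a, 0, 0)}"
    proof
      fix v assume v: "v \<in> ?S"
      have "idot (0, snd v) (0, snd v) = 0" using sub[OF v] 2(2) by linarith
      then have "(0, snd v) = (0::int, 0::int, 0::int)" by (simp only: idot_self_eq_0)
      then show "v \<in> {(a, 0, 0)}" using v by (cases v) auto
    qed
    then have "card ?S \<le> card {(a, 0::int, 0::int)}" by (intro card_mono) auto
    then show ?thesis using T4 by simp
  next
    case 3
    let ?f = "\<lambda>v::ivec. ((0::int, snd v), (1::int, 0::int, 0::int))"
    have "inj_on ?f ?S" by (auto simp: inj_on_def)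
    moreover have "?f ` ?S \<subseteq> orth_pairs (int n - a * a) 1"
    proof (rule image_subsetI)
      fix v assume v: "v \<in> ?S"
      have "idot (0, snd v) (1, 0, 0) = 0" by (cases v) simp
      then show "?f v \<in> orth_pairs (int n - a * a) 1"
        using sub[OF v] by (simp add: orth_pairs_def)
    qed
    ultimately have "card ?S \<le> card (orth_pairs (int n - a * a) 1)"
      using finite_orth_pairs by (intro card_inj_on_le)
    \<comment> \<open>With second norm 1 the gcd is 1, so only the divisor factors remain.\<close>
    also have "real (card (orth_pairs (int n - a * a) 1)) \<le> 432 * of_int (gcd (int n - a * a) 1) * T ^ 4"
    proof (rule orth_pairs_bound)
      have "a * a \<ge> 0" by simp
      then show "int n - a * a \<le> 4 * int n" by linarith
    qed (use 3 n in auto)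
    finally show ?thesis by simp
  qed
qed

text \<open>The sphere is cut by its first coordinate into at most
  \<open>2 * sqrt n + 1 \<le> 3 * sqrt n\<close> circles. This serves to count the degenerate pairs
  \<open>y = x\<close> and \<open>y = -x\<close>.\<close>

lemma card_int_sphere_le: "real (card (int_sphere n)) \<le> 3 * 432 * T ^ 4 * sqrt n"
proof -
  define s where "s = \<lfloor>sqrt (real n)\<rfloor>"
  have s: "s \<ge> 0" by (simp add: s_def)
  have sub: "fst ` int_sphere n \<subseteq> {-s..s}"
  proof (rule image_subsetI)
    fix v assume v: "v \<in> int_sphere n"
    obtain a b c where eq: "v = (a, b, c)" by (cases v) auto
    have "a * a + b * b + c * c = int n" using v by (simp add: eq int_sphere_def)
    moreover have "b * b \<ge> 0" "c * c \<ge> 0" by auto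
    ultimately have "a * a \<le> int n" by linarith
    then have "real_of_int (a * a) \<le> real_of_int (int n)" by (simp only: of_int_le_iff)
    then have "(of_int \<bar>a\<bar>)\<^sup>2 \<le> real n" by (simp add: power2_eq_square)
    then have "of_int \<bar>a\<bar> \<le> sqrt (real n)" by (rule real_le_rsqrt)
    then have "\<bar>a\<bar> \<le> s" unfolding s_def by (simp only: le_floor_iff)
    then show "fst v \<in> {-s..s}" by (auto simp: eq)
  qed
  have "real (card (int_sphere n)) = (\<Sum>a\<in>fst ` int_sphere n. real (card {v \<in> int_sphere n. fst v = a}))"
    using sum.image_gen[OF finite_int_sphere, of "\<lambda>_. 1::real" n fst] by simp
  also have "\<dots> \<le> (\<Sum>a\<in>fst ` int_sphere n. 432 * T ^ 4)"
    by (intro sum_mono card_sphere_slice_le)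
  also have "\<dots> = real (card (fst ` int_sphere n)) * (432 * T ^ 4)" by simp
  also have "\<dots> \<le> (3 * sqrt n) * (432 * T ^ 4)"
  proof (rule mult_right_mono)
    have "card (fst ` int_sphere n) \<le> card {-s..s}" using sub by (intro card_mono) auto
    then have "real (card (fst ` int_sphere n)) \<le> 2 * of_int s + 1" using s by simp
    also have "of_int s \<le> sqrt (real n)" by (simp add: s_def)
    also have "2 * sqrt (real n) + 1 \<le> 3 * sqrt (real n)" using n by simp
    finally show "real (card (fst ` int_sphere n)) \<le> 3 * sqrt n" by simp
  qed (use T1 in simp)
  finally show ?thesis by (simp add: mult_ac)
qed

text \<open>Nondegenerate pairs map injectively to orthogonal pairs \<open>(x + y, x - y)\<close>,
  and \<open>gcd (4 n - h) h = gcd (4 n) h\<close> makes the sum over \<open>h\<close> an average of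
  gcds. The fifth power of \<open>T\<close> comes from \<open>tau (4 n)\<close> in that
  average.\<close>

lemma card_close_pairs_le:
  assumes "H \<ge> 0"
  shows "real (card {(x, y) \<in> int_sphere n \<times> int_sphere n. idot (x - y) (x - y) \<le> H})
    \<le> 432 * T ^ 5 * (6 * sqrt n + of_int H)"
proof -
  let ?E = "int_sphere n"
  let ?S = "{(x, y) \<in> ?E \<times> ?E. idot (x - y) (x - y) \<le> H}"
  let ?R = "{(x, y) \<in> ?E \<times> ?E. idot (x - y) (x - y) \<le> H \<and> x - y \<noteq> (0, 0, 0) \<and> x + y \<noteq> (0, 0, 0)}"
  \<comment> \<open>The bound \<open>h < 4 n\<close> keeps the norm \<open>4 n - h\<close> of
    \<open>x + y\<close> positive.\<close>
  let ?J = "{h \<in> {1..H}. h < 4 * int n}"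
  let ?O = "\<lambda>h. orth_pairs (4 * int n - h) h"
  have finE: "finite ?E" by (rule finite_int_sphere)
  have finR: "finite ?R" by (rule finite_subset[of _ "?E \<times> ?E"]) (auto simp: finE)
  have finJ: "finite ?J" by (rule finite_subset[of _ "{1..H}"]) auto
  have "?S \<subseteq> (\<lambda>x. (x, x)) ` ?E \<union> (\<lambda>x. (x, iscale (-1) x)) ` ?E \<union> ?R"
  proof (rule subsetI)
    fix p assume p: "p \<in> ?S"
    obtain x1 x2 x3 y1 y2 y3 where eq: "p = ((x1, x2, x3), (y1, y2, y3))" by (cases p) auto
    have mem: "(x1, x2, x3) \<in> ?E" "(y1, y2, y3) \<in> ?E" using p eq by auto
    consider "(x1, x2, x3) - (y1, y2, y3) = (0, 0, 0)" | "(x1, x2, x3) + (y1, y2, y3) = (0, 0, 0)" | "p \<in> ?R"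
      using p unfolding eq by auto
    then show "p \<in> (\<lambda>x. (x, x)) ` ?E \<union> (\<lambda>x. (x, iscale (-1) x)) ` ?E \<union> ?R"
    proof cases
      case 1
      then have "p = ((x1, x2, x3), (x1, x2, x3))" by (simp add: eq)
      then show ?thesis using mem by blast
    next
      case 2
      then have "p = ((x1, x2, x3), iscale (-1) (x1, x2, x3))" by (simp add: eq eq_neg_iff_add_eq_0 add.commute)
      then show ?thesis using mem by blast
    next
      case 3
      then show ?thesis by blast
    qed
  qed
  then have "card ?S \<le> card ((\<lambda>x. (x, x)) ` ?E \<union> (\<lambda>x. (x, iscale (-1) x)) ` ?E \<union> ?R)"
    using finE finR by (intro card_mono) auto
  also have "\<dots> \<le> card ((\<lambda>x. (x, x)) ` ?E \<union> (\<lambda>x. (x, iscale (-1) x)) ` ?E) + card ?R"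
    by (rule card_Un_le)
  also have "\<dots> \<le> card ((\<lambda>x. (x, x)) ` ?E) + card ((\<lambda>x. (x, iscale (-1) x)) ` ?E) + card ?R"
    by (intro add_right_mono card_Un_le)
  also have "\<dots> \<le> card ?E + card ?E + card ?R"
    using finE by (intro add_mono card_image_le order_refl)
  finally have S: "real (card ?S) \<le> 2 * real (card ?E) + real (card ?R)" by linarith
  let ?f = "\<lambda>(x, y). (x + y, x - y) :: ivec \<times> ivec"
  have "inj_on ?f ?R"
  proof (rule inj_onI)
    fix p q assume "?f p = ?f q"
    moreover obtain x1 x2 x3 y1 y2 y3 where "p = ((x1, x2, x3), (y1, y2, y3))" by (cases p) auto
    moreover obtain u1 u2 u3 v1 v2 v3 where "q = ((u1, u2, u3), (v1, v2, v3))" by (cases q) auto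
    ultimately show "p = q" by simp
  qed
  moreover have "?f ` ?R \<subseteq> (\<Union>h\<in>?J. ?O h)"
  proof (rule image_subsetI)
    fix p assume p: "p \<in> ?R"
    obtain x y where eq: "p = (x, y)" by (cases p)
    have xy: "idot x x = int n" "idot y y = int n" "idot (x - y) (x - y) \<le> H"
      "x - y \<noteq> (0, 0, 0)" "x + y \<noteq> (0, 0, 0)" using p by (auto simp: eq int_sphere_def)
    define h where "h = idot (x - y) (x - y)"
    have par: "idot (x + y) (x + y) + idot (x - y) (x - y) = 2 * idot x x + 2 * idot y y"
      "idot (x + y) (x - y) = idot x x - idot y y"
      by (cases x; cases y; simp add: algebra_simps)+
    have "h \<noteq> 0" "idot (x + y) (x + y) \<noteq> 0"
      using xy idot_self_eq_0 unfolding h_def by blast+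
    then have "h > 0" "idot (x + y) (x + y) > 0"
      using idot_self_nonneg[of "x - y"] idot_self_nonneg[of "x + y"] unfolding h_def by linarith+
    then have "h \<in> ?J" using xy par unfolding h_def by auto
    moreover have "?f p \<in> ?O h" using par xy unfolding h_def eq orth_pairs_def by auto
    ultimately show "?f p \<in> (\<Union>h\<in>?J. ?O h)" by blast
  qed
  ultimately have "card ?R \<le> card (\<Union>h\<in>?J. ?O h)"
    using finJ finite_orth_pairs by (intro card_inj_on_le[of ?f]) auto
  also have "\<dots> \<le> (\<Sum>h\<in>?J. card (?O h))" by (rule card_UN_le[OF finJ])
  finally have "real (card ?R) \<le> (\<Sum>h\<in>?J. real (card (?O h)))"
    by (simp only: of_nat_le_iff of_nat_sum[symmetric])
  also have "\<dots> \<le> (\<Sum>h\<in>?J. 432 * of_int (gcd (4 * int n) h) * T ^ 4)"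
  proof (rule sum_mono)
    fix h assume h: "h \<in> ?J"
    have "gcd (4 * int n - h) h = gcd (4 * int n) h"
      using gcd_add1[of "4 * int n - h" h] by simp
    then show "real (card (?O h)) \<le> 432 * of_int (gcd (4 * int n) h) * T ^ 4"
      using orth_pairs_bound[of "4 * int n - h" h] h by auto
  qed
  also have "\<dots> \<le> (\<Sum>h\<in>{1..H}. 432 * of_int (gcd (4 * int n) h) * T ^ 4)"
    using T1 by (intro sum_mono2) auto
  also have "\<dots> = 432 * T ^ 4 * of_int (\<Sum>h\<in>{1..H}. gcd (4 * int n) h)"
    by (simp add: sum_distrib_left mult_ac)
  also have "\<dots> \<le> 432 * T ^ 4 * of_int (H * int (tau (4 * int n)))"
    using T1 n assms by (intro mult_left_mono, unfold of_int_le_iff, intro sum_gcd_le) auto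
  also have "\<dots> = 432 * T ^ 4 * (of_int H * real (tau (4 * int n)))" by simp
  also have "\<dots> \<le> 432 * T ^ 4 * (of_int H * T)"
    using T1 assms n by (intro mult_left_mono tau_le) auto
  finally have R: "real (card ?R) \<le> 432 * T ^ 5 * of_int H"
    by (simp add: eval_nat_numeral mult_ac)
  \<comment> \<open>The 6 is twice the 3 of the sphere bound, once for each degenerate
    family.\<close>
  have "2 * real (card ?E) \<le> 432 * T ^ 4 * (6 * sqrt n)"
    using card_int_sphere_le by (simp add: mult_ac)
  also have "\<dots> \<le> 432 * T ^ 5 * (6 * sqrt n)"
    using T1 by (intro mult_right_mono mult_left_mono power_increasing) auto
  finally show ?thesis using S R unfolding distrib_left by linarith
qed

end

section \<open>Real lattice points and partitions of the sphere\<close>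

definition real_vec :: "ivec \<Rightarrow> real^3" where
  "real_vec v = vector [of_int (fst v), of_int (fst (snd v)), of_int (snd (snd v))]"

lemma norm_real_vec_diff: "(norm (real_vec u - real_vec v))\<^sup>2 = of_int (idot (u - v) (u - v))"
  unfolding power2_norm_eq_inner
  by (cases u; cases v) (simp add: real_vec_def inner_vec_def sum_3)

lemma latticeSphere_eq: "latticeSphere n = real_vec ` int_sphere n"
proof (intro equalityI subsetI)
  fix x assume "x \<in> latticeSphere n"
  then have x: "\<And>i. x $ i \<in> \<int>" "(norm x)\<^sup>2 = real n" by (auto simp: latticeSphere_def)
  define v where "v = (\<lfloor>x $ 1\<rfloor>, \<lfloor>x $ 2\<rfloor>, \<lfloor>x $ 3\<rfloor>)"
  have xv: "x = real_vec v"
    using x(1) by (simp add: vec_eq_iff forall_3 real_vec_def v_def)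
  have "real_vec (0, 0, 0) = 0" by (simp add: vec_eq_iff forall_3 real_vec_def)
  then have "(norm (real_vec v))\<^sup>2 = of_int (idot v v)"
    using norm_real_vec_diff[of v "(0, 0, 0)"] by (cases v) simp
  then have "idot v v = int n" using x(2) xv by simp
  then show "x \<in> real_vec ` int_sphere n" using xv by (simp add: int_sphere_def)
next
  fix x assume "x \<in> real_vec ` int_sphere n"
  then obtain v where v: "x = real_vec v" "idot v v = int n" by (auto simp: int_sphere_def)
  have "real_vec (0, 0, 0) = 0" by (simp add: vec_eq_iff forall_3 real_vec_def)
  then have "(norm (real_vec v))\<^sup>2 = of_int (idot v v)"
    using norm_real_vec_diff[of v "(0, 0, 0)"] by (cases v) simp
  then show "x \<in> latticeSphere n"
    using v by (simp add: latticeSphere_def forall_3 real_vec_def)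
qed

text \<open>Each square counts ordered pairs of points in one part; disjoint parts give disjoint
  sets of pairs, all at distance at most \<open>r\<close>.\<close>

lemma sum_card_squares_le:
  fixes P :: "'a::metric_space set set"
  assumes "finite L" "disjoint P" "\<And>A x y. A \<in> P \<Longrightarrow> x \<in> A \<Longrightarrow> y \<in> A \<Longrightarrow> dist x y \<le> r"
  shows "(\<Sum>A\<in>{A\<in>P. A \<inter> L \<noteq> {}}. card (A \<inter> L) ^ 2) \<le> card {(x, y) \<in> L \<times> L. dist x y \<le> r}"
proof -
  let ?Q = "{A\<in>P. A \<inter> L \<noteq> {}}"
  have disj: "A \<inter> B = {}" if "A \<in> P" "B \<in> P" "A \<noteq> B" for A B
    using assms(2) that by (auto simp: disjoint_def)
  \<comment> \<open>Disjoint parts that meet \<open>L\<close> have distinct traces on it, so only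
    finitely many parts count even if \<open>P\<close> is infinite.\<close>
  have "inj_on (\<lambda>A. A \<inter> L) ?Q"
    unfolding inj_on_def using disj by blast
  moreover have "(\<lambda>A. A \<inter> L) ` ?Q \<subseteq> Pow L" by auto
  ultimately have finQ: "finite ?Q" using assms(1) by (meson finite_Pow_iff inj_on_finite)
  have "(\<Sum>A\<in>?Q. card (A \<inter> L) ^ 2) = (\<Sum>A\<in>?Q. card ((A \<inter> L) \<times> (A \<inter> L)))"
    by (simp add: card_cartesian_product power2_eq_square)
  also have "\<dots> = card (\<Union>A\<in>?Q. (A \<inter> L) \<times> (A \<inter> L))"
  proof (rule card_UN_disjoint[symmetric, OF finQ])
    show "\<forall>A\<in>?Q. finite ((A \<inter> L) \<times> (A \<inter> L))" using assms(1) by simp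
    show "\<forall>A\<in>?Q. \<forall>B\<in>?Q. A \<noteq> B \<longrightarrow> ((A \<inter> L) \<times> (A \<inter> L)) \<inter> ((B \<inter> L) \<times> (B \<inter> L)) = {}"
      using disj by blast
  qed
  also have "\<dots> \<le> card {(x, y) \<in> L \<times> L. dist x y \<le> r}"
  proof (rule card_mono)
    show "finite {(x, y) \<in> L \<times> L. dist x y \<le> r}"
      by (rule finite_subset[of _ "L \<times> L"]) (auto simp: assms(1))
  qed (use assms(3) in auto)
  finally show ?thesis .
qed

text \<open>The sum runs over the parts that meet the lattice points because a partition may be
  infinite, and a sum over an infinite index set would default to 0.\<close>

theorem mainTheorem10:
  fixes C \<epsilon> :: real
  assumes "C > 0" and "\<epsilon> > 0"
  shows "\<exists>K. \<forall>n::nat. \<forall>P :: (real^3) set set.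
           n \<ge> 1 \<and> \<Union>P = sphere 0 (sqrt (real n)) \<and> disjoint P \<and>
           (\<forall>A\<in>P. \<forall>x\<in>A. \<forall>y\<in>A. dist x y \<le> C * real n powr (1/4))
           \<longrightarrow> real (\<Sum>A\<in>{A\<in>P. A \<inter> latticeSphere n \<noteq> {}}. card (A \<inter> latticeSphere n) ^ 2)
               \<le> K * real n powr (1/2 + \<epsilon>)"
proof -
  \<comment> \<open>Five divisor factors, each at most \<open>B * N powr \<delta>\<close> with
    \<open>N = 16 n^2\<close>, contribute \<open>N powr (\<epsilon> / 2)\<close>, that is
    \<open>n powr \<epsilon>\<close> up to a constant.\<close>
  define \<delta> where "\<delta> = \<epsilon> / 10"
  have "\<delta> > 0" using assms by (simp add: \<delta>_def)
  then obtain B where B: "B \<ge> 1" "\<And>k. k > 0 \<Longrightarrow> real (tau k) \<le> B * of_int k powr \<delta>"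
    using divisor_bound by blast
  have bound: "real (\<Sum>A\<in>{A\<in>P. A \<inter> latticeSphere n \<noteq> {}}. card (A \<inter> latticeSphere n) ^ 2)
      \<le> (432 * B ^ 5 * 16 powr (\<epsilon> / 2) * (6 + C\<^sup>2)) * real n powr (1/2 + \<epsilon>)"
    if n: "n \<ge> 1" and disj: "disjoint P"
      and diam: "\<And>A x y. A \<in> P \<Longrightarrow> x \<in> A \<Longrightarrow> y \<in> A \<Longrightarrow> dist x y \<le> C * real n powr (1/4)"
    for n :: nat and P :: "(real^3) set set"
  proof -
    let ?L = "latticeSphere n"
    define r where "r = C * real n powr (1/4)"
    \<comment> \<open>Squared distances of integer points are integers, so rounding down loses no
      pair.\<close>
    define H where "H = \<lfloor>r\<^sup>2\<rfloor>"
    define N where "N = 16 * real n * real n"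
    define T where "T = B * N powr \<delta>"
    have "1 * 1 \<le> real n * real n" using n by (intro mult_mono) auto
    then have N1: "N \<ge> 1" unfolding N_def by linarith
    have r0: "r \<ge> 0" using assms by (simp add: r_def)
    have "(real n powr (1/4))\<^sup>2 = sqrt n"
      using n by (simp add: powr_power powr_half_sqrt)
    then have r2: "r\<^sup>2 = C\<^sup>2 * sqrt n" by (simp add: r_def power_mult_distrib)
    interpret tau_bounded n T
    proof
      show "n \<ge> 1" by (rule n)
      have "1 * 1 \<le> B * N powr \<delta>"
        using B N1 \<open>\<delta> > 0\<close> by (intro mult_mono ge_one_powr_ge_zero) auto
      then show "T \<ge> 1" by (simp add: T_def)
      fix k :: int assume k: "0 < k" "k \<le> 16 * int n * int n"
      then have "real_of_int k \<le> real_of_int (16 * int n * int n)" by (simp only: of_int_le_iff)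
      then have kN: "of_int k \<le> N" by (simp add: N_def)
      have "real (tau k) \<le> B * of_int k powr \<delta>" using B k by blast
      also have "\<dots> \<le> T" unfolding T_def
        using B kN k \<open>\<delta> > 0\<close> by (intro mult_left_mono powr_mono2) auto
      finally show "real (tau k) \<le> T" .
    qed
    have "T ^ 5 = B ^ 5 * N powr (\<epsilon> / 2)"
      using N1 by (simp add: T_def power_mult_distrib powr_power \<delta>_def)
    also have "N powr (\<epsilon> / 2) = 16 powr (\<epsilon> / 2) * real n powr \<epsilon>"
      using n by (simp add: N_def powr_mult powr_add[symmetric])
    finally have T5: "T ^ 5 = B ^ 5 * (16 powr (\<epsilon> / 2) * real n powr \<epsilon>)" .
    have finL: "finite ?L" unfolding latticeSphere_eq using finite_int_sphere by simp
    have finZ: "finite {(x, y) \<in> int_sphere n \<times> int_sphere n. idot (x - y) (x - y) \<le> H}"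
      by (rule finite_subset[of _ "int_sphere n \<times> int_sphere n"]) (auto simp: finite_int_sphere)
    have "(\<Sum>A\<in>{A\<in>P. A \<inter> ?L \<noteq> {}}. card (A \<inter> ?L) ^ 2) \<le> card {(x, y) \<in> ?L \<times> ?L. dist x y \<le> r}"
      using diam unfolding r_def by (intro sum_card_squares_le finL disj)
    also have "\<dots> \<le> card {(x, y) \<in> int_sphere n \<times> int_sphere n. idot (x - y) (x - y) \<le> H}"
    proof (rule surj_card_le[OF finZ])
      show "{(x, y) \<in> ?L \<times> ?L. dist x y \<le> r} \<subseteq>
          map_prod real_vec real_vec ` {(x, y) \<in> int_sphere n \<times> int_sphere n. idot (x - y) (x - y) \<le> H}"
      proof
        fix p assume "p \<in> {(x, y) \<in> ?L \<times> ?L. dist x y \<le> r}"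
        then obtain u v where uv: "p = (real_vec u, real_vec v)" "u \<in> int_sphere n" "v \<in> int_sphere n"
          "norm (real_vec u - real_vec v) \<le> r"
          unfolding latticeSphere_eq by (auto simp: dist_norm)
        have "(norm (real_vec u - real_vec v))\<^sup>2 \<le> r\<^sup>2" using uv(4) by (intro power_mono) auto
        then have "of_int (idot (u - v) (u - v)) \<le> r\<^sup>2" unfolding norm_real_vec_diff .
        then have "idot (u - v) (u - v) \<le> H" unfolding H_def by (simp only: le_floor_iff)
        then have "(u, v) \<in> {(x, y) \<in> int_sphere n \<times> int_sphere n. idot (x - y) (x - y) \<le> H}"
          using uv by simp
        moreover have "p = map_prod real_vec real_vec (u, v)" using uv by simp
        ultimately show "p \<in> map_prod real_vec real_vec `
            {(x, y) \<in> int_sphere n \<times> int_sphere n. idot (x - y) (x - y) \<le> H}" by blast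
      qed
    qed
    finally have "real (\<Sum>A\<in>{A\<in>P. A \<inter> ?L \<noteq> {}}. card (A \<inter> ?L) ^ 2)
        \<le> real (card {(x, y) \<in> int_sphere n \<times> int_sphere n. idot (x - y) (x - y) \<le> H})"
      by (simp only: of_nat_le_iff)
    also have "\<dots> \<le> 432 * T ^ 5 * (6 * sqrt n + of_int H)"
      by (rule card_close_pairs_le) (simp add: H_def)
    also have "\<dots> \<le> 432 * T ^ 5 * (6 * sqrt n + C\<^sup>2 * sqrt n)"
      using T1 r2 by (intro mult_left_mono add_left_mono) (auto simp: H_def)
    also have "\<dots> = (432 * B ^ 5 * 16 powr (\<epsilon> / 2) * (6 + C\<^sup>2)) * (real n powr \<epsilon> * sqrt n)"
      unfolding T5 by (simp add: algebra_simps)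
    also have "real n powr \<epsilon> * sqrt n = real n powr (1/2 + \<epsilon>)"
      using n by (simp add: powr_add powr_half_sqrt)
    finally show ?thesis .
  qed
  show ?thesis
    by (intro exI[of _ "432 * B ^ 5 * 16 powr (\<epsilon> / 2) * (6 + C\<^sup>2)"] allI impI bound) auto
qed

end
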